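(* Let $X$ be a random variable with mean $\mu$ and $\mathbb{E}X^4<\infty$, which is either (a) integer-valued with probability mass function $p$ having a Pearson quadratic form $q(j)=\delta(j-\mu)^2+\beta(j-\mu)+\gamma$, i.e. $\sum_{k\le j}(\mu-k)p(k)=q(j)p(j)$ for all $j\in\mathbb{Z}$, and with support $J(X)=\{j\in\mathbb{Z}:p(j)>0\}$ satisfying $|J(X)|\ge 3$; or (b) continuous with density $f$ having a Pearson quadratic form $q(x)=\delta(x-\mu)^2+\beta(x-\mu)+\gamma$, i.e. $\int_{-\infty}^{x}(\mu-t)f(t)\,dt=q(x)f(x)$ for all $x\in\mathbb{R}$. Let $X_1,\dots,X_n$ be a random sample from $X$ which, in case (a), contains at least three distinct values, and, in case (b), consists of at least three observations. Let $\overline{X}_n=\frac1n\sum_{j=1}^n X_j$, $m_{k;n}=\frac1n\sum_{j=1}^n (X_j-\overline{X}_n)^k$, and $\widehat{\Theta}_n=m_{4;n}m_{2;n}-m_{3;n}^2-m_{2;n}^3$. Then $\widehat{\Theta}_n$ is a positive number (in case (b), almost surely), and the moment estimators of $\delta,\beta,\gamma$ are: (a) in the integer-valued case, $\widehat{\delta}_n=\dfrac{2m_{4;n}m_{2;n}-3m_{3;n}^2-6m_{2;n}^3+m_{2;n}^2}{6\widehat{\Theta}_n}$, $\widehat{\beta}_n=\dfrac{m_{3;n}(1-2\widehat{\delta}_n)-m_{2;n}}{2m_{2;n}}=\dfrac{m_{4;n}m_{3;n}-3m_{4;n}m_{2;n}+3m_{3;n}^2+3m_{3;n}m_{2;n}^2-m_{3;n}m_{2;n}+3m_{2;n}^3}{6\widehat{\Theta}_n}$,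 $\widehat{\gamma}_n=m_{2;n}(1-\widehat{\delta}_n)=\dfrac{4m_{4;n}m_{2;n}^2-3m_{3;n}^2m_{2;n}-m_{2;n}^3}{6\widehat{\Theta}_n}$; (b) in the continuous case, $\widehat{\delta}_n=\dfrac{2m_{4;n}m_{2;n}-3m_{3;n}^2-6m_{2;n}^3}{6\widehat{\Theta}_n}$, $\widehat{\beta}_n=\dfrac{m_{3;n}(1-2\widehat{\delta}_n)}{2m_{2;n}}=\dfrac{m_{4;n}m_{3;n}+3m_{3;n}m_{2;n}^2}{6\widehat{\Theta}_n}$, $\widehat{\gamma}_n=m_{2;n}(1-\widehat{\delta}_n)=\dfrac{4m_{4;n}m_{2;n}^2-3m_{3;n}^2m_{2;n}}{6\widehat{\Theta}_n}$. Moreover, $\widehat{\delta}_n\to\delta$, $\widehat{\beta}_n\to\beta$, $\widehat{\gamma}_n\to\gamma$ almost surely as $n\to\infty$.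
   Context: A moment estimator here means the estimator obtained by replacing the central moments $\mu_k=\mathbb{E}(X-\mu)^k$, $k=2,3,4$, in the expressions for $\delta,\beta,\gamma$ as functions of $\mu_2,\mu_3,\mu_4$ (determined by the Pearson quadratic form identity) by the sample central moments $m_{k;n}$. *)

theory Defs
  imports "HOL-Probability.Probability"
begin

definition pearson_q :: "real \<Rightarrow> real \<Rightarrow> real \<Rightarrow> real \<Rightarrow> real \<Rightarrow> real" where
  "pearson_q \<delta> \<beta> \<gamma> mu x = \<delta> * (x - mu)^2 + \<beta> * (x - mu) + \<gamma>"

definition int_pmf :: "'a measure \<Rightarrow> ('a \<Rightarrow> real) \<Rightarrow> int \<Rightarrow> real" where
  "int_pmf M X j = measure M {\<omega> \<in> space M. X \<omega> = real_of_int j}"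

definition pop_cmom :: "'a measure \<Rightarrow> ('a \<Rightarrow> real) \<Rightarrow> nat \<Rightarrow> real" where
  "pop_cmom M X k = integral\<^sup>L M (\<lambda>\<omega>. (X \<omega> - integral\<^sup>L M X) ^ k)"

definition sample_mean :: "(nat \<Rightarrow> 'a \<Rightarrow> real) \<Rightarrow> nat \<Rightarrow> 'a \<Rightarrow> real" where
  "sample_mean Xs n \<omega> = (\<Sum>j<n. Xs j \<omega>) / real n"

definition sample_cmom :: "(nat \<Rightarrow> 'a \<Rightarrow> real) \<Rightarrow> nat \<Rightarrow> nat \<Rightarrow> 'a \<Rightarrow> real" where
  "sample_cmom Xs k n \<omega> = (\<Sum>j<n. (Xs j \<omega> - sample_mean Xs n \<omega>) ^ k) / real n"

definition Theta :: "real \<Rightarrow> real \<Rightarrow> real \<Rightarrow> real" where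
  "Theta m2 m3 m4 = m4 * m2 - m3^2 - m2^3"

definition delta_disc :: "real \<Rightarrow> real \<Rightarrow> real \<Rightarrow> real" where
  "delta_disc m2 m3 m4 = (2*m4*m2 - 3*m3^2 - 6*m2^3 + m2^2) / (6 * Theta m2 m3 m4)"

definition beta_disc :: "real \<Rightarrow> real \<Rightarrow> real \<Rightarrow> real" where
  "beta_disc m2 m3 m4 =
     (m4*m3 - 3*m4*m2 + 3*m3^2 + 3*m3*m2^2 - m3*m2 + 3*m2^3) / (6 * Theta m2 m3 m4)"

definition gamma_disc :: "real \<Rightarrow> real \<Rightarrow> real \<Rightarrow> real" where
  "gamma_disc m2 m3 m4 = (4*m4*m2^2 - 3*m3^2*m2 - m2^3) / (6 * Theta m2 m3 m4)"

definition delta_cont :: "real \<Rightarrow> real \<Rightarrow> real \<Rightarrow> real" where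
  "delta_cont m2 m3 m4 = (2*m4*m2 - 3*m3^2 - 6*m2^3) / (6 * Theta m2 m3 m4)"

definition beta_cont :: "real \<Rightarrow> real \<Rightarrow> real \<Rightarrow> real" where
  "beta_cont m2 m3 m4 = (m4*m3 + 3*m3*m2^2) / (6 * Theta m2 m3 m4)"

definition gamma_cont :: "real \<Rightarrow> real \<Rightarrow> real \<Rightarrow> real" where
  "gamma_cont m2 m3 m4 = (4*m4*m2^2 - 3*m3^2*m2) / (6 * Theta m2 m3 m4)"

end

theory Submission
  imports Defs
begin

text \<open>
  With \<open>Z = X - \<mu>\<close>, the Pearson identity gives Stein's identity
  \<open>E[Z (G(X) - G(c))] = E[q(X) G'(X)]\<close> (with the forward difference of \<open>G\<close> instead of \<open>G'\<close>
  in the integer case). For \<open>G = (x - \<mu>)^k\<close>, \<open>k = 1, 2, 3\<close>, this is a linear system for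
  \<open>\<delta>, \<beta>, \<gamma>\<close> whose solution has denominator
  \<open>\<Theta> = \<mu>\<^sub>2 E[(Z^2 - (\<mu>\<^sub>3 / \<mu>\<^sub>2) Z - \<mu>\<^sub>2)^2]\<close>, positive unless \<open>X\<close> takes at most two values;
  the sample version is the same statement for the empirical distribution. Consistency is the strong
  law of large numbers for the powers of \<open>X - \<mu>\<close> and continuity. The strong law is obtained from
  a maximal argument: a random walk with negative drift is almost surely bounded above.
\<close>

section \<open>The strong law of large numbers\<close>

text \<open>\<open>Theta\<close> is the Gram determinant of 1, Z, Z^2 under the law considered, so
  it vanishes exactly when these are linearly dependent almost surely; this is where the three-point
  conditions come from. The factor 6 = 1 * 2 * 3 collects the leading coefficients k of the
  derivatives or differences of (x - mu)^k.

  Two obstacles shape the proof. Only E X^4 is finite, so (X - mu)^4 has a mean but possibly no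
  variance, and a strong law based on second moments would not reach the fourth sample moment.
  Integration by parts would need boundary terms at infinity; they are avoided by applying Fubini
  over the region between a fixed point c and X, where the integrand is dominated by powers of |X -
  mu| up to 4, exactly what k \<le> 3 permits.

  In the density case three distinct observations must also be produced: independent variables
  without atoms almost surely never coincide.\<close>

fun walk_max :: "nat \<Rightarrow> (nat \<Rightarrow> real) \<Rightarrow> real" where
  "walk_max 0 x = 0"
| "walk_max (Suc n) x = max 0 (x 0 + walk_max n (\<lambda>i. x (Suc i)))"

lemma walk_max_nonneg: "0 \<le> walk_max n x"
  by (cases n) auto

text \<open>\<open>walk_max n x\<close> is the largest partial sum of length at most n, the empty
  sum included. Its recursion peels off the first step, not the last, so that it fits the shift of
  an i.i.d. sequence.\<close>

lemma sum_le_walk_max: "k \<le> n \<Longrightarrow> (\<Sum>i<k. x i) \<le> walk_max n x"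
proof (induction n arbitrary: k x)
  case (Suc n)
  show ?case
  proof (cases k)
    case (Suc l)
    then show ?thesis
      using Suc.IH[of l "\<lambda>i. x (Suc i)"] Suc.prems
      by (simp add: sum.lessThan_Suc_shift le_max_iff_disj del: sum.lessThan_Suc)
  qed (simp add: walk_max_nonneg)
qed simp

lemma walk_max_mono: "m \<le> n \<Longrightarrow> walk_max m x \<le> walk_max n x"
proof (induction m arbitrary: n x)
  case (Suc m)
  then obtain l where "n = Suc l" "m \<le> l"
    by (cases n) auto
  with Suc.IH[of l "\<lambda>i. x (Suc i)"] show ?case
    by simp
qed (simp add: walk_max_nonneg)

lemma walk_max_le_sum_abs: "walk_max n x \<le> (\<Sum>i<n. \<bar>x i\<bar>)"
proof (induction n arbitrary: x)
  case (Suc n)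
  have "0 \<le> (\<Sum>i<n. \<bar>x (Suc i)\<bar>)" by (intro sum_nonneg) auto
  with Suc.IH[of "\<lambda>i. x (Suc i)"] show ?case
    by (simp add: sum.lessThan_Suc_shift del: sum.lessThan_Suc)
qed simp

text \<open>The bound ranges over naturals so that the event is a countable combination of
  measurable ones.\<close>

definition walk_unbounded :: "(nat \<Rightarrow> real) \<Rightarrow> bool" where
  "walk_unbounded x \<longleftrightarrow> (\<forall>C::nat. \<exists>n. real C < walk_max n x)"

text \<open>Dropping the first step moves all later partial sums by the constant \<open>x 0\<close>.
  This makes the event shift-invariant, hence independent of the first coordinate.\<close>

lemma walk_unbounded_shift: "walk_unbounded x \<longleftrightarrow> walk_unbounded (\<lambda>i. x (Suc i))"
proof
  assume x: "walk_unbounded x"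
  show "walk_unbounded (\<lambda>i. x (Suc i))"
    unfolding walk_unbounded_def
  proof
    fix C :: nat
    obtain D :: nat where D: "real C + x 0 < real D" and "real C < real D"
      using reals_Archimedean2[of "max (real C) (real C + x 0)"] by auto
    obtain n where n: "real D < walk_max n x"
      using x by (auto simp: walk_unbounded_def)
    then obtain m where "n = Suc m" by (cases n) auto
    with n D show "\<exists>n. real C < walk_max n (\<lambda>i. x (Suc i))"
      by (intro exI[of _ m]) auto
  qed
next
  assume x: "walk_unbounded (\<lambda>i. x (Suc i))"
  show "walk_unbounded x"
    unfolding walk_unbounded_def
  proof
    fix C :: nat
    obtain D :: nat where D: "real C - x 0 < real D"
      using reals_Archimedean2 by blast
    obtain n where n: "real D < walk_max n (\<lambda>i. x (Suc i))"
      using x by (auto simp: walk_unbounded_def)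
    with D show "\<exists>n. real C < walk_max n x"
      by (intro exI[of _ "Suc n"]) auto
  qed
qed

text \<open>The maxima increase beyond every bound, so \<open>- walk_max n x\<close> finally drops
  below \<open>s\<close>. This is the pointwise limit for the dominated convergence
  argument.\<close>

lemma walk_unbounded_imp_max_eventually:
  assumes "walk_unbounded x"
  shows "eventually (\<lambda>n. max (- walk_max n x) s = s) sequentially"
proof -
  obtain C :: nat where C: "- s < real C"
    using reals_Archimedean2 by blast
  obtain n where n: "real C < walk_max n x"
    using assms by (auto simp: walk_unbounded_def)
  show ?thesis
    using walk_max_mono[of n _ x] n C
    by (intro eventually_sequentiallyI[of n]) (smt (verit))
qed

lemma (in pair_sigma_finite)
  fixes u :: "'a \<Rightarrow> real" and v :: "'b \<Rightarrow> real"
  assumes u: "integrable M1 u" and v: "integrable M2 v"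
  shows integrable_pair_mult: "integrable (M1 \<Otimes>\<^sub>M M2) (\<lambda>(x, y). u x * v y)"
    and integral_pair_mult: "(\<integral>(x, y). u x * v y \<partial>(M1 \<Otimes>\<^sub>M M2)) = (\<integral>x. u x \<partial>M1) * (\<integral>y. v y \<partial>M2)"
proof -
  have [measurable]: "u \<in> borel_measurable M1" "v \<in> borel_measurable M2"
    using u v by auto
  show *: "integrable (M1 \<Otimes>\<^sub>M M2) (\<lambda>(x, y). u x * v y)"
  proof (rule Fubini_integrable)
    show "integrable M1 (\<lambda>x. \<integral>y. norm (case (x, y) of (x, y) \<Rightarrow> u x * v y) \<partial>M2)"
      using u v by (simp add: abs_mult)
    show "AE x in M1. integrable M2 (\<lambda>y. case (x, y) of (x, y) \<Rightarrow> u x * v y)"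
      using v by simp
  qed simp
  show "(\<integral>(x, y). u x * v y \<partial>(M1 \<Otimes>\<^sub>M M2)) = (\<integral>x. u x \<partial>M1) * (\<integral>y. v y \<partial>M2)"
    using integral_fst[OF *] by simp
qed

section \<open>Random walks with independent, identically distributed steps\<close>

context sequence_space
begin

lemma integrable_component:
  fixes g :: "'a \<Rightarrow> real"
  assumes g: "integrable M g"
  shows "integrable S (\<lambda>\<omega>. g (\<omega> i))"
proof -
  have "distr S M (\<lambda>\<omega>. \<omega> i) = M"
    using PiM_component[of i] by simp
  with g have "integrable (distr S M (\<lambda>\<omega>. \<omega> i)) g" by simp
  then show ?thesis
    by (subst (asm) integrable_distr_eq) (use g in auto)
qed

text \<open>The offset \<open>k\<close> is there for the induction: the recursion evaluates the walk
  that starts one coordinate later.\<close>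

lemma measurable_walk_max:
  fixes g :: "'a \<Rightarrow> real"
  assumes [measurable]: "g \<in> borel_measurable M"
  shows "(\<lambda>\<omega>. walk_max n (\<lambda>i. g (\<omega> (k + i)))) \<in> borel_measurable S"
proof (induction n arbitrary: k)
  case (Suc n)
  note [measurable] = Suc.IH[of "Suc k", simplified]
  show ?case by simp
qed simp

lemma integrable_walk_max:
  fixes g :: "'a \<Rightarrow> real"
  assumes g: "integrable M g"
  shows "integrable S (\<lambda>\<omega>. walk_max n (\<lambda>i. g (\<omega> i)))"
proof (rule Bochner_Integration.integrable_bound)
  show "integrable S (\<lambda>\<omega>. \<Sum>i<n. \<bar>g (\<omega> i)\<bar>)"
    using g by (intro Bochner_Integration.integrable_sum integrable_abs integrable_component)
  show "(\<lambda>\<omega>. walk_max n (\<lambda>i. g (\<omega> i))) \<in> borel_measurable S"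
    using measurable_walk_max[of g n 0] g by auto
  show "AE \<omega> in S. norm (walk_max n (\<lambda>i. g (\<omega> i))) \<le> norm (\<Sum>i<n. \<bar>g (\<omega> i)\<bar>)"
    using walk_max_nonneg walk_max_le_sum_abs by (auto intro!: AE_I2 simp: abs_of_nonneg intro: order_trans[OF _ abs_ge_self])
qed

lemma measurable_walk_unbounded:
  fixes g :: "'a \<Rightarrow> real"
  assumes [measurable]: "g \<in> borel_measurable M"
  shows "Measurable.pred S (\<lambda>\<omega>. walk_unbounded (\<lambda>i. g (\<omega> i)))"
  unfolding walk_unbounded_def using measurable_walk_max[of g _ 0] by simp

text \<open>
  On the shift-invariant event \<open>A\<close> that the walk is unbounded, the running maxima satisfy
  \<open>0 \<le> E[(walk_max (n+1) - walk_max n) 1\<^sub>A] = E[max (- walk_max n) g 1\<^sub>A]\<close>,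
  where \<open>g\<close> is independent of \<open>walk_max n\<close> and \<open>A\<close>; the right-hand side tends to
  \<open>E g \<cdot> P A\<close>.
\<close>

lemma AE_bounded_walk:
  fixes g :: "'a \<Rightarrow> real"
  assumes g: "integrable M g" and neg: "(\<integral>x. g x \<partial>M) < 0"
  shows "AE \<omega> in S. \<not> walk_unbounded (\<lambda>i. g (\<omega> i))"
proof -
  have [measurable]: "g \<in> borel_measurable M" using g by auto
  interpret PS: pair_prob_space M S ..
  define A where "A = {\<omega> \<in> space S. walk_unbounded (\<lambda>i. g (\<omega> i))}"
  have A[measurable]: "A \<in> sets S"
    unfolding A_def using measurable_walk_unbounded[of g] by simp
  define W where "W n \<omega> = walk_max n (\<lambda>i. g (\<omega> i))" for n \<omega>
  have W[measurable]: "W n \<in> borel_measurable S" for n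
    unfolding W_def using measurable_walk_max[of g n 0] by simp
  have W_int: "integrable S (\<lambda>\<omega>. W n \<omega> * indicator A \<omega>)" for n
    unfolding W_def using integrable_walk_max[OF g, of n]
    by (intro integrable_real_mult_indicator) auto
  have W_Suc: "W (Suc n) (case_nat s \<omega>) * indicator A (case_nat s \<omega>)
      = max 0 (g s + W n \<omega>) * indicator A \<omega>"
    if "s \<in> space M" "\<omega> \<in> space S" for n s \<omega>
  proof -
    have "case_nat s \<omega> \<in> space S"
      using that by (auto simp: space_PiM PiE_iff split: nat.split)
    then show ?thesis
      using that walk_unbounded_shift[of "\<lambda>i. g (case_nat s \<omega> i)"]
      by (simp add: W_def A_def indicator_def)
  qed
  have shift: "(\<lambda>(s, \<omega>). case_nat s \<omega>) \<in> M \<Otimes>\<^sub>M S \<rightarrow>\<^sub>M S" by simp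
  have Wsnd: "integrable (M \<Otimes>\<^sub>M S) (\<lambda>(s, \<omega>). W n \<omega> * indicator A \<omega>)"
    and Wsnd_eq: "(\<integral>(s, \<omega>). W n \<omega> * indicator A \<omega> \<partial>(M \<Otimes>\<^sub>M S)) = (\<integral>\<omega>. W n \<omega> * indicator A \<omega> \<partial>S)" for n
    using PS.integrable_pair_mult[OF _ W_int, of "\<lambda>_. 1" n] PS.integral_pair_mult[OF _ W_int, of "\<lambda>_. 1" n]
    by (simp_all add: M.prob_space)
  \<comment> \<open>Prepending an independent \<open>M\<close>-distributed coordinate reproduces the
    law \<open>S\<close> (\<open>PiM_iter\<close>), so expectations over \<open>S\<close> can be
    computed over the product of \<open>M\<close> and \<open>S\<close>.\<close>
  have W_distr: "integrable (distr (M \<Otimes>\<^sub>M S) S (\<lambda>(s, \<omega>). case_nat s \<omega>)) (\<lambda>\<omega>. W n \<omega> * indicator A \<omega>)" for n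
    unfolding PiM_iter by (rule W_int)
  have Wshift: "integrable (M \<Otimes>\<^sub>M S) (\<lambda>(s, \<omega>). max 0 (g s + W n \<omega>) * indicator A \<omega>)" for n
    using W_distr[of "Suc n"]
    by (subst (asm) integrable_distr_eq[OF shift], simp)
       (rule Bochner_Integration.integrable_cong[THEN iffD1, rotated 2], assumption, auto simp: W_Suc space_pair_measure)
  have Wshift_eq: "(\<integral>(s, \<omega>). max 0 (g s + W n \<omega>) * indicator A \<omega> \<partial>(M \<Otimes>\<^sub>M S))
      = (\<integral>\<omega>. W (Suc n) \<omega> * indicator A \<omega> \<partial>S)" for n
    by (subst PiM_iter[symmetric], subst integral_distr[OF shift], simp)
       (rule Bochner_Integration.integral_cong, auto simp: W_Suc space_pair_measure)
  have gA: "integrable (M \<Otimes>\<^sub>M S) (\<lambda>(s, \<omega>). g s * indicator A \<omega>)"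
    and gA_eq: "(\<integral>(s, \<omega>). g s * indicator A \<omega> \<partial>(M \<Otimes>\<^sub>M S)) = (\<integral>x. g x \<partial>M) * measure S A"
    using PS.integrable_pair_mult[OF g, of "indicator A"] PS.integral_pair_mult[OF g, of "indicator A"]
    by (simp_all add: P.emeasure_eq_measure)
  have lim: "(\<lambda>n. \<integral>(s, \<omega>). max (- W n \<omega>) (g s) * indicator A \<omega> \<partial>(M \<Otimes>\<^sub>M S))
    \<longlonglongrightarrow> (\<integral>(s, \<omega>). g s * indicator A \<omega> \<partial>(M \<Otimes>\<^sub>M S))"
  proof (rule integral_dominated_convergence)
    show "integrable (M \<Otimes>\<^sub>M S) (\<lambda>x. \<bar>case x of (s, \<omega>) \<Rightarrow> g s * indicator A \<omega>\<bar>)"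
      using gA by simp
    show "AE x in M \<Otimes>\<^sub>M S. (\<lambda>n. case x of (s, \<omega>) \<Rightarrow> max (- W n \<omega>) (g s) * indicator A \<omega>)
        \<longlonglongrightarrow> (case x of (s, \<omega>) \<Rightarrow> g s * indicator A \<omega>)"
    proof (intro AE_I2, clarify)
      fix s \<omega>
      show "(\<lambda>n. max (- W n \<omega>) (g s) * indicator A \<omega>) \<longlonglongrightarrow> g s * indicator A \<omega>"
        using walk_unbounded_imp_max_eventually[of "\<lambda>i. g (\<omega> i)" "g s"]
        by (cases "\<omega> \<in> A") (auto simp: A_def W_def intro: tendsto_eventually)
    qed
    \<comment> \<open>As W \<ge> 0, either the maximum is g itself, or g < -W \<le> 0 and then |-W|
      \<le> |g|.\<close>
    show "AE x in M \<Otimes>\<^sub>M S. norm (case x of (s, \<omega>) \<Rightarrow> max (- W n \<omega>) (g s) * indicator A \<omega>)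
        \<le> \<bar>case x of (s, \<omega>) \<Rightarrow> g s * indicator A \<omega>\<bar>" for n
      using walk_max_nonneg[of n] by (intro AE_I2) (auto simp: W_def indicator_def max_def abs_if, (smt (verit))+)
  qed auto
  have nonneg: "0 \<le> (\<integral>(s, \<omega>). max (- W n \<omega>) (g s) * indicator A \<omega> \<partial>(M \<Otimes>\<^sub>M S))" for n
  proof -
    have le: "(\<integral>\<omega>. W n \<omega> * indicator A \<omega> \<partial>S) \<le> (\<integral>\<omega>. W (Suc n) \<omega> * indicator A \<omega> \<partial>S)"
      using walk_max_mono[of n "Suc n"]
      by (intro integral_mono W_int mult_right_mono) (auto simp: W_def simp del: walk_max.simps)
    have "(\<integral>\<omega>. W (Suc n) \<omega> * indicator A \<omega> \<partial>S) - (\<integral>\<omega>. W n \<omega> * indicator A \<omega> \<partial>S)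
      = (\<integral>x. (case x of (s, \<omega>) \<Rightarrow> max 0 (g s + W n \<omega>) * indicator A \<omega>)
          - (case x of (s, \<omega>) \<Rightarrow> W n \<omega> * indicator A \<omega>) \<partial>(M \<Otimes>\<^sub>M S))"
      by (subst Bochner_Integration.integral_diff[OF Wshift Wsnd]) (simp only: Wsnd_eq Wshift_eq)
    \<comment> \<open>Pointwise, max 0 (g + W) - W = max (-W) g.\<close>
    also have "\<dots> = (\<integral>(s, \<omega>). max (- W n \<omega>) (g s) * indicator A \<omega> \<partial>(M \<Otimes>\<^sub>M S))"
      by (intro Bochner_Integration.integral_cong) (auto simp: indicator_def max_def)
    finally show ?thesis using le by simp
  qed
  have "0 \<le> (\<integral>(s, \<omega>). g s * indicator A \<omega> \<partial>(M \<Otimes>\<^sub>M S))"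
    using lim nonneg by (intro LIMSEQ_le_const) auto
  also note gA_eq
  finally have "measure S A = 0"
    using neg by (smt (verit) mult_neg_pos measure_nonneg mult_less_0_iff)
  then have "A \<in> null_sets S"
    by (simp add: null_sets_def P.emeasure_eq_measure)
  then show ?thesis
    by (intro AE_I'[of A]) (auto simp: A_def)
qed

text \<open>Subtracting slightly more than the mean gives a walk with drift \<open>- e k\<close>,
  which is bounded above; so the sums stay below C + n (mean + \<open>e k\<close>). Doing this for g
  and -g, along the countable sequence \<open>e k\<close>, squeezes the averages.\<close>

theorem strong_law_of_large_numbers:
  fixes g :: "'a \<Rightarrow> real"
  assumes g: "integrable M g"
  shows "AE \<omega> in S. (\<lambda>n. (\<Sum>i<n. g (\<omega> i)) / real n) \<longlonglongrightarrow> (\<integral>x. g x \<partial>M)"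
proof -
  define e where "e k = inverse (real (Suc k))" for k
  have upper: "AE \<omega> in S. \<forall>k. \<exists>C. \<forall>n. (\<Sum>i<n. h (\<omega> i)) \<le> C + real n * ((\<integral>x. h x \<partial>M) + e k)"
    if h: "integrable M h" for h :: "'a \<Rightarrow> real"
    unfolding AE_all_countable
  proof
    fix k
    define u where "u x = h x - ((\<integral>x. h x \<partial>M) + e k)" for x
    have "(\<integral>x. u x \<partial>M) < 0"
      unfolding u_def using h by (simp add: M.prob_space e_def)
    moreover have "integrable M u"
      unfolding u_def using h by simp
    ultimately have "AE \<omega> in S. \<not> walk_unbounded (\<lambda>i. u (\<omega> i))"
      by (intro AE_bounded_walk)
    then show "AE \<omega> in S. \<exists>C. \<forall>n. (\<Sum>i<n. h (\<omega> i)) \<le> C + real n * ((\<integral>x. h x \<partial>M) + e k)"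
    proof eventually_elim
      case (elim \<omega>)
      then obtain C :: nat where "\<And>n. walk_max n (\<lambda>i. u (\<omega> i)) \<le> real C"
        by (auto simp: walk_unbounded_def not_less)
      then have "(\<Sum>i<n. u (\<omega> i)) \<le> real C" for n
        using sum_le_walk_max[of n n "\<lambda>i. u (\<omega> i)"] by (meson order_trans order_refl)
      then show ?case
        by (intro exI[of _ "real C"]) (simp add: u_def sum_subtractf algebra_simps)
    qed
  qed
  have "integrable M (\<lambda>x. - g x)" using g by simp
  from upper[OF g] upper[OF this] show ?thesis
  proof eventually_elim
    case (elim \<omega>)
    let ?S = "\<lambda>n. \<Sum>i<n. g (\<omega> i)" and ?m = "\<integral>x. g x \<partial>M"
    show ?case
    proof (rule LIMSEQ_I)
      fix r :: real assume r: "0 < r"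
      then obtain k where k: "e k < r / 2"
        using reals_Archimedean[of "r / 2"] by (auto simp: e_def)
      from elim(1) obtain C where C: "\<And>n. ?S n \<le> C + real n * (?m + e k)" by blast
      from elim(2) obtain D where D: "\<And>n. - ?S n \<le> D + real n * (- ?m + e k)"
        by (auto simp: sum_negf)
      \<comment> \<open>Half of \<open>r\<close> absorbs the constants C and D divided by n, the
        other half absorbs \<open>e k\<close>. Below, n starts at \<open>Suc N\<close> so that n > 0
        even when N = 0.\<close>
      obtain N :: nat where N: "2 * max C D / r < real N"
        using reals_Archimedean2 by blast
      have "norm (?S n / real n - ?m) < r" if n: "Suc N \<le> n" for n
      proof -
        have n0: "real n > 0" using n by simp
        have "2 * max C D < real N * r" using N r by (simp add: field_simps)
        also have "\<dots> \<le> real n * r" using n r by (intro mult_right_mono) auto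
        finally have CD: "2 * max C D < real n * r" .
        have ek: "real n * e k \<le> real n * (r / 2)"
          using k n0 by (intro mult_left_mono) auto
        have "?S n - real n * ?m < real n * r" "- (?S n - real n * ?m) < real n * r"
          using C[of n] D[of n] CD ek by (simp_all add: algebra_simps)
        then have "\<bar>?S n - real n * ?m\<bar> < real n * r" by linarith
        moreover have "?S n / real n - ?m = (?S n - real n * ?m) / real n"
          using n0 by (simp add: field_simps)
        ultimately show ?thesis
          using n0 by (simp add: abs_divide field_simps)
      qed
      then show "\<exists>no. \<forall>n\<ge>no. norm (?S n / real n - ?m) < r" by blast
    qed
  qed
qed

end

section \<open>Positivity of the determinant and the moment equations\<close>

text \<open>Powers up to 4 are dominated by 1 plus the fourth one. The 8 arises from using (a - b)^2
  \<le> 2 (a^2 + b^2), or its analogue for sums, twice. The instance k = 1, c = 0 yields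
  integrability of the variable itself.\<close>

lemma (in prob_space) integrable_centered_power:
  fixes Y :: "'a \<Rightarrow> real"
  assumes Y[measurable]: "Y \<in> borel_measurable M"
    and fourth: "integrable M (\<lambda>\<omega>. Y \<omega> ^ 4)" and "k \<le> 4"
  shows "integrable M (\<lambda>\<omega>. (Y \<omega> - c) ^ k)"
proof (rule Bochner_Integration.integrable_bound)
  show "integrable M (\<lambda>\<omega>. 1 + 8 * (Y \<omega> ^ 4 + c ^ 4))"
    using fourth by simp
  have "norm ((y - c) ^ k) \<le> norm (1 + 8 * (y ^ 4 + c ^ 4))" for y
  proof -
    have "\<bar>y - c\<bar> ^ k \<le> 1 + \<bar>y - c\<bar> ^ 4"
    proof (cases "\<bar>y - c\<bar> \<le> 1")
      case True
      then show ?thesis using power_le_one[of "\<bar>y - c\<bar>" k] by (simp add: add_increasing2)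
    next
      case False
      then show ?thesis using power_increasing[of k 4 "\<bar>y - c\<bar>"] \<open>k \<le> 4\<close> by simp
    qed
    also have "\<bar>y - c\<bar> ^ 4 = ((y - c)\<^sup>2)\<^sup>2"
      by simp
    also have "\<dots> \<le> (2 * (y\<^sup>2 + c\<^sup>2))\<^sup>2"
      using zero_le_power2[of "y + c"] zero_le_power2[of "y - c"]
      by (intro power_mono) (auto simp: power2_eq_square algebra_simps)
    also have "\<dots> \<le> 8 * (y ^ 4 + c ^ 4)"
      using zero_le_power2[of "y\<^sup>2 - c\<^sup>2"] by (simp add: power2_eq_square power4_eq_xxxx algebra_simps)
    finally show ?thesis
      by (simp add: power_abs)
  qed
  then show "AE \<omega> in M. norm ((Y \<omega> - c) ^ k) \<le> norm (1 + 8 * (Y \<omega> ^ 4 + c ^ 4))"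
    by simp
qed simp

lemma (in prob_space) pop_cmom_1:
  assumes "integrable M Y"
  shows "pop_cmom M Y 1 = 0"
  using assms by (simp add: pop_cmom_def prob_space)

lemma (in prob_space) pop_cmom_positive:
  fixes Y :: "'a \<Rightarrow> real"
  assumes Y[measurable]: "Y \<in> borel_measurable M"
    and fourth: "integrable M (\<lambda>\<omega>. Y \<omega> ^ 4)"
    and three: "\<And>a b. \<not> (AE \<omega> in M. Y \<omega> = a \<or> Y \<omega> = b)"
  shows "0 < pop_cmom M Y 2"
    and "0 < Theta (pop_cmom M Y 2) (pop_cmom M Y 3) (pop_cmom M Y 4)"
proof -
  define m where "m = expectation Y"
  define Z where "Z \<omega> = Y \<omega> - m" for \<omega>
  have [measurable]: "Z \<in> borel_measurable M"
    unfolding Z_def by simp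
  have mom: "pop_cmom M Y k = (\<integral>\<omega>. Z \<omega> ^ k \<partial>M)" for k
    by (simp add: pop_cmom_def Z_def m_def)
  have int: "integrable M (\<lambda>\<omega>. Z \<omega> ^ k)" if "k \<le> 4" for k
    unfolding Z_def using integrable_centered_power[OF Y fourth that] .
  have int1: "integrable M Z" "integrable M (\<lambda>\<omega>. Z \<omega> ^ 2)" "integrable M (\<lambda>\<omega>. Z \<omega> ^ 3)"
    "integrable M (\<lambda>\<omega>. Z \<omega> ^ 4)"
    using int[of 1] int[of 2] int[of 3] int[of 4] by simp_all
  have "integrable M Y"
    using integrable_centered_power[OF Y fourth, of 1 0] by simp
  then have m1: "(\<integral>\<omega>. Z \<omega> \<partial>M) = 0"
    by (simp add: Z_def m_def prob_space)
  show pos2: "0 < pop_cmom M Y 2"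
  proof (rule ccontr)
    assume "\<not> 0 < pop_cmom M Y 2"
    moreover have "0 \<le> (\<integral>\<omega>. Z \<omega> ^ 2 \<partial>M)" by simp
    ultimately have "(\<integral>\<omega>. Z \<omega> ^ 2 \<partial>M) = 0"
      unfolding mom by simp
    then have "AE \<omega> in M. Z \<omega> ^ 2 = 0"
      using int1(2) by (subst (asm) integral_nonneg_eq_0_iff_AE) auto
    \<comment> \<open>The disjunction is doubled to match \<open>three\<close> with both points
      equal to \<open>m\<close>.\<close>
    then have "AE \<omega> in M. Y \<omega> = m \<or> Y \<omega> = m"
      by eventually_elim (simp add: Z_def)
    with three show False by blast
  qed
  \<comment> \<open>a Z + b is the orthogonal projection of Z^2 onto the span of Z and 1, which are
    orthogonal because E Z = 0. The integral below is the squared length of the residual.\<close>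
  define a where "a = pop_cmom M Y 3 / pop_cmom M Y 2"
  define b where "b = pop_cmom M Y 2"
  have poly: "(Z \<omega> ^ 2 - a * Z \<omega> - b)\<^sup>2
    = Z \<omega> ^ 4 - 2 * a * Z \<omega> ^ 3 + (a\<^sup>2 - 2 * b) * Z \<omega> ^ 2 + 2 * a * b * Z \<omega> + b\<^sup>2" for \<omega>
    by (simp add: power2_eq_square power4_eq_xxxx power3_eq_cube algebra_simps)
  have int_poly: "integrable M (\<lambda>\<omega>. (Z \<omega> ^ 2 - a * Z \<omega> - b)\<^sup>2)"
    unfolding poly using int1 by simp
  have "(\<integral>\<omega>. (Z \<omega> ^ 2 - a * Z \<omega> - b)\<^sup>2 \<partial>M)
      = pop_cmom M Y 4 - 2 * a * pop_cmom M Y 3 + (a\<^sup>2 - 2 * b) * pop_cmom M Y 2 + b\<^sup>2"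
    unfolding poly mom using int1 m1 by (simp add: prob_space)
  also have "\<dots> = Theta (pop_cmom M Y 2) (pop_cmom M Y 3) (pop_cmom M Y 4) / pop_cmom M Y 2"
    unfolding a_def b_def Theta_def using pos2
    by (simp add: field_simps power2_eq_square power3_eq_cube)
  finally have eq: "(\<integral>\<omega>. (Z \<omega> ^ 2 - a * Z \<omega> - b)\<^sup>2 \<partial>M)
      = Theta (pop_cmom M Y 2) (pop_cmom M Y 3) (pop_cmom M Y 4) / pop_cmom M Y 2" .
  show "0 < Theta (pop_cmom M Y 2) (pop_cmom M Y 3) (pop_cmom M Y 4)"
  proof (rule ccontr)
    assume "\<not> ?thesis"
    \<comment> \<open>Root of the discriminant of z^2 - a z - b, which is positive since b is the
      variance. A vanishing residual confines Z to the two roots.\<close>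
    define d where "d = sqrt (a\<^sup>2 + 4 * b)"
    from \<open>\<not> ?thesis\<close> have "(\<integral>\<omega>. (Z \<omega> ^ 2 - a * Z \<omega> - b)\<^sup>2 \<partial>M) \<le> 0"
      unfolding eq using pos2 by (simp add: divide_nonpos_pos)
    moreover have "0 \<le> (\<integral>\<omega>. (Z \<omega> ^ 2 - a * Z \<omega> - b)\<^sup>2 \<partial>M)" by simp
    ultimately have "(\<integral>\<omega>. (Z \<omega> ^ 2 - a * Z \<omega> - b)\<^sup>2 \<partial>M) = 0" by linarith
    then have "AE \<omega> in M. (Z \<omega> ^ 2 - a * Z \<omega> - b)\<^sup>2 = 0"
      using int_poly by (subst (asm) integral_nonneg_eq_0_iff_AE) auto
    then have "AE \<omega> in M. Y \<omega> = m + (a + d) / 2 \<or> Y \<omega> = m + (a - d) / 2"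
    proof eventually_elim
      case (elim \<omega>)
      have "d\<^sup>2 = a\<^sup>2 + 4 * b"
        unfolding d_def using pos2 by (simp add: b_def)
      moreover have "(Z \<omega> - (a + d) / 2) * (Z \<omega> - (a - d) / 2)
          = Z \<omega> ^ 2 - a * Z \<omega> + (a\<^sup>2 - d\<^sup>2) / 4"
        by (simp add: field_simps power2_eq_square)
      ultimately have "(Z \<omega> - (a + d) / 2) * (Z \<omega> - (a - d) / 2) = 0"
        using elim(1) by (simp add: field_simps)
      then have "Z \<omega> = (a + d) / 2 \<or> Z \<omega> = (a - d) / 2" by simp
      then show ?case
        unfolding Z_def by linarith
    qed
    with three show False by blast
  qed
qed

text \<open>Here \<open>\<omega>\<close> is fixed and the index j is the random point, so statements
  about arbitrary laws apply to one observed sample.\<close>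

lemma pop_cmom_pmf_of_set:
  assumes "0 < n"
  shows "pop_cmom (measure_pmf (pmf_of_set {..<n})) (\<lambda>j. Xs j \<omega>) k = sample_cmom Xs k n \<omega>"
  using assms
  by (simp add: pop_cmom_def sample_cmom_def sample_mean_def integral_pmf_of_set lessThan_empty_iff)

lemma sample_cmom_positive:
  fixes Xs :: "nat \<Rightarrow> 'a \<Rightarrow> real"
  assumes card: "3 \<le> card ((\<lambda>j. Xs j \<omega>) ` {..<n})"
  shows "0 < sample_cmom Xs 2 n \<omega>"
    and
      "0 < Theta (sample_cmom Xs 2 n \<omega>) (sample_cmom Xs 3 n \<omega>) (sample_cmom Xs 4 n \<omega>)"
proof -
  have n: "0 < n" using card by (cases n) auto
  let ?p = "pmf_of_set {..<n}"
  have three: "\<not> (AE j in measure_pmf ?p. Xs j \<omega> = a \<or> Xs j \<omega> = b)" for a b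
  proof
    assume "AE j in measure_pmf ?p. Xs j \<omega> = a \<or> Xs j \<omega> = b"
    then have "(\<lambda>j. Xs j \<omega>) ` {..<n} \<subseteq> {a, b}"
      using n by (auto simp: AE_measure_pmf_iff lessThan_empty_iff)
    then have "card ((\<lambda>j. Xs j \<omega>) ` {..<n}) \<le> card {a, b}"
      by (intro card_mono) auto
    also have "\<dots> \<le> 2" by (simp add: card_insert_le_m1)
    finally show False using card by simp
  qed
  have "integrable (measure_pmf ?p) (\<lambda>j. Xs j \<omega> ^ 4)"
    using n by (intro integrable_measure_pmf_finite) (simp add: lessThan_empty_iff)
  note pos = measure_pmf.pop_cmom_positive[of "\<lambda>j. Xs j \<omega>" ?p, OF _ this three]
  show "0 < sample_cmom Xs 2 n \<omega>"
    "0 < Theta (sample_cmom Xs 2 n \<omega>) (sample_cmom Xs 3 n \<omega>) (sample_cmom Xs 4 n \<omega>)"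
    using pos by (simp_all add: pop_cmom_pmf_of_set[OF n])
qed

text \<open>By independence the joint law is the product law. The section of the diagonal at each y
  is the null event X = y, so the diagonal is null by Fubini.\<close>

lemma (in prob_space) AE_indep_var_neq:
  fixes X Y :: "'a \<Rightarrow> real"
  assumes indep: "indep_var borel X borel Y"
    and no_atoms: "\<And>x. prob {\<omega> \<in> space M. X \<omega> = x} = 0"
  shows "AE \<omega> in M. X \<omega> \<noteq> Y \<omega>"
proof -
  have [measurable]: "X \<in> borel_measurable M" "Y \<in> borel_measurable M"
    using indep_var_rv1[OF indep] indep_var_rv2[OF indep] by auto
  interpret DX: prob_space "distr M borel X" by (rule prob_space_distr) simp
  interpret DY: prob_space "distr M borel Y" by (rule prob_space_distr) simp
  interpret D: pair_prob_space "distr M borel X" "distr M borel Y" ..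
  have sets[measurable_cong]: "sets (distr M borel X \<Otimes>\<^sub>M distr M borel Y) = sets (borel \<Otimes>\<^sub>M borel)"
    by (intro sets_pair_measure_cong) simp_all
  have "Measurable.pred (borel \<Otimes>\<^sub>M borel) (\<lambda>p::real \<times> real. fst p \<noteq> snd p)"
    by measurable
  then have neq: "{p \<in> space (distr M borel X \<Otimes>\<^sub>M distr M borel Y). fst p \<noteq> snd p}
      \<in> sets (distr M borel X \<Otimes>\<^sub>M distr M borel Y)"
    unfolding sets sets_eq_imp_space_eq[OF sets] by (simp add: pred_def)
  have "AE y in distr M borel Y. AE x in distr M borel X. x \<noteq> y"
  proof (rule AE_I2)
    fix y
    have "emeasure M {\<omega> \<in> space M. X \<omega> = y} = 0"
      using no_atoms[of y] by (simp add: emeasure_eq_measure)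
    then show "AE x in distr M borel X. x \<noteq> y"
      by (subst AE_distr_iff) (auto simp: AE_iff_measurable[OF _ refl])
  qed
  then have "AE x in distr M borel X. AE y in distr M borel Y. x \<noteq> y"
    by (subst D.AE_commute[OF neq])
  then have "AE p in distr M borel X \<Otimes>\<^sub>M distr M borel Y. fst p \<noteq> snd p"
    by (subst (asm) D.AE_pair_iff[OF neq])
  then have "AE p in distr M (borel \<Otimes>\<^sub>M borel) (\<lambda>\<omega>. (X \<omega>, Y \<omega>)). fst p \<noteq> snd p"
    using indep_var_distribution_eq[THEN iffD1, OF indep] by (simp only:)
  then show ?thesis
    by (subst (asm) AE_distr_iff) auto
qed

section \<open>Solving the moment equations\<close>

lemma beta_gamma_disc_alt:
  assumes "m2 \<noteq> 0" "Theta m2 m3 m4 \<noteq> 0"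
  shows beta_disc_alt: "beta_disc m2 m3 m4 = (m3 * (1 - 2 * delta_disc m2 m3 m4) - m2) / (2 * m2)"
    and gamma_disc_alt: "gamma_disc m2 m3 m4 = m2 * (1 - delta_disc m2 m3 m4)"
proof -
  \<comment> \<open>With \<open>Theta\<close> hidden behind a nonzero \<open>T\<close>,
    \<open>divide_simps\<close> can clear denominators; its definition returns only in the remaining
    polynomial identities.\<close>
  obtain T where T: "T = Theta m2 m3 m4" "T \<noteq> 0" using assms by blast
  note T_eq = T(1)[unfolded Theta_def]
  show "beta_disc m2 m3 m4 = (m3 * (1 - 2 * delta_disc m2 m3 m4) - m2) / (2 * m2)"
    unfolding beta_disc_def delta_disc_def T(1)[symmetric] using T(2) assms(1)
    by (simp add: divide_simps) (use T_eq in algebra)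
  show "gamma_disc m2 m3 m4 = m2 * (1 - delta_disc m2 m3 m4)"
    unfolding gamma_disc_def delta_disc_def T(1)[symmetric] using T(2)
    by (simp add: divide_simps) (use T_eq in algebra)
qed

lemma beta_gamma_cont_alt:
  assumes "m2 \<noteq> 0" "Theta m2 m3 m4 \<noteq> 0"
  shows beta_cont_alt: "beta_cont m2 m3 m4 = m3 * (1 - 2 * delta_cont m2 m3 m4) / (2 * m2)"
    and gamma_cont_alt: "gamma_cont m2 m3 m4 = m2 * (1 - delta_cont m2 m3 m4)"
proof -
  obtain T where T: "T = Theta m2 m3 m4" "T \<noteq> 0" using assms by blast
  note T_eq = T(1)[unfolded Theta_def]
  show "beta_cont m2 m3 m4 = m3 * (1 - 2 * delta_cont m2 m3 m4) / (2 * m2)"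
    unfolding beta_cont_def delta_cont_def T(1)[symmetric] using T(2) assms(1)
    by (simp add: divide_simps) (use T_eq in algebra)
  show "gamma_cont m2 m3 m4 = m2 * (1 - delta_cont m2 m3 m4)"
    unfolding gamma_cont_def delta_cont_def T(1)[symmetric] using T(2)
    by (simp add: divide_simps) (use T_eq in algebra)
qed

text \<open>The equations are Stein's identity for Z, Z^2, Z^3 with forward differences 1, 2 Z + 1,
  3 Z^2 + 3 Z + 1. The first gives \<gamma> and the second \<beta> in terms of \<delta>; inserting
  both into 2 m2 times the third leaves \<delta> * 6 Theta.\<close>

lemma moment_equations_disc:
  assumes "m2 \<noteq> 0" "Theta m2 m3 m4 \<noteq> 0"
    and 1: "m2 = \<delta> * m2 + \<gamma>"
    and 2: "m3 = 2 * (\<delta> * m3 + \<beta> * m2) + (\<delta> * m2 + \<gamma>)"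
    and 3: "m4 = 3 * (\<delta> * m4 + \<beta> * m3 + \<gamma> * m2) + 3 * (\<delta> * m3 + \<beta> * m2) + (\<delta> * m2 + \<gamma>)"
  shows "\<delta> = delta_disc m2 m3 m4 \<and> \<beta> = beta_disc m2 m3 m4 \<and> \<gamma> = gamma_disc m2 m3 m4"
proof -
  have "\<delta> * (6 * Theta m2 m3 m4) = 2*m4*m2 - 3*m3^2 - 6*m2^3 + m2^2"
    using 1 2 3 unfolding Theta_def by algebra
  then have d: "\<delta> = delta_disc m2 m3 m4"
    unfolding delta_disc_def using assms(2) by (simp add: eq_divide_eq)
  have "\<beta> * (2 * m2) = m3 * (1 - 2 * \<delta>) - m2"
    using 1 2 by algebra
  then have "\<beta> = beta_disc m2 m3 m4"
    unfolding beta_disc_alt[OF assms(1,2)] d[symmetric] using assms(1) by (simp add: eq_divide_eq)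
  moreover have "\<gamma> = gamma_disc m2 m3 m4"
    unfolding gamma_disc_alt[OF assms(1,2)] d[symmetric] using 1 by (simp add: algebra_simps)
  ultimately show ?thesis using d by simp
qed

text \<open>Same elimination with the derivatives 1, 2 Z, 3 Z^2, so the lower-order terms of the
  integer system are absent.\<close>

lemma moment_equations_cont:
  assumes "m2 \<noteq> 0" "Theta m2 m3 m4 \<noteq> 0"
    and 1: "m2 = \<delta> * m2 + \<gamma>"
    and 2: "m3 = 2 * (\<delta> * m3 + \<beta> * m2)"
    and 3: "m4 = 3 * (\<delta> * m4 + \<beta> * m3 + \<gamma> * m2)"
  shows "\<delta> = delta_cont m2 m3 m4 \<and> \<beta> = beta_cont m2 m3 m4 \<and> \<gamma> = gamma_cont m2 m3 m4"
proof -
  have "\<delta> * (6 * Theta m2 m3 m4) = 2*m4*m2 - 3*m3^2 - 6*m2^3"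
    using 1 2 3 unfolding Theta_def by algebra
  then have d: "\<delta> = delta_cont m2 m3 m4"
    unfolding delta_cont_def using assms(2) by (simp add: eq_divide_eq)
  have "\<beta> * (2 * m2) = m3 * (1 - 2 * \<delta>)"
    using 2 by algebra
  then have "\<beta> = beta_cont m2 m3 m4"
    unfolding beta_cont_alt[OF assms(1,2)] d[symmetric] using assms(1) by (simp add: eq_divide_eq)
  moreover have "\<gamma> = gamma_cont m2 m3 m4"
    unfolding gamma_cont_alt[OF assms(1,2)] d[symmetric] using 1 by (simp add: algebra_simps)
  ultimately show ?thesis using d by simp
qed

lemma tendsto_estimators:
  assumes "Theta a2 a3 a4 \<noteq> 0"
    and [tendsto_intros]: "(m2 \<longlongrightarrow> a2) F" "(m3 \<longlongrightarrow> a3) F" "(m4 \<longlongrightarrow> a4) F"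
  shows "((\<lambda>n. delta_disc (m2 n) (m3 n) (m4 n)) \<longlongrightarrow> delta_disc a2 a3 a4) F"
    and "((\<lambda>n. beta_disc (m2 n) (m3 n) (m4 n)) \<longlongrightarrow> beta_disc a2 a3 a4) F"
    and "((\<lambda>n. gamma_disc (m2 n) (m3 n) (m4 n)) \<longlongrightarrow> gamma_disc a2 a3 a4) F"
    and "((\<lambda>n. delta_cont (m2 n) (m3 n) (m4 n)) \<longlongrightarrow> delta_cont a2 a3 a4) F"
    and "((\<lambda>n. beta_cont (m2 n) (m3 n) (m4 n)) \<longlongrightarrow> beta_cont a2 a3 a4) F"
    and "((\<lambda>n. gamma_cont (m2 n) (m3 n) (m4 n)) \<longlongrightarrow> gamma_cont a2 a3 a4) F"
  unfolding delta_disc_def beta_disc_def gamma_disc_def delta_cont_def beta_cont_def gamma_cont_def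
  using assms(1) unfolding Theta_def by (auto intro!: tendsto_intros)

section \<open>Stein's identity\<close>

text \<open>Signed indicator of the interval between c and x. Including the left and excluding the
  right endpoint makes sums of G (t + 1) - G t over the integers telescope to G x - G c, and makes t
  \<ge> x agree with the tail event X \<le> t.\<close>

definition crossing :: "real \<Rightarrow> real \<Rightarrow> real \<Rightarrow> real" where
  "crossing c x t = (if c \<le> t \<and> t < x then 1 else if x \<le> t \<and> t < c then - 1 else 0)"

lemma measurable_crossing[measurable]:
  assumes [measurable]: "u \<in> borel_measurable N" "v \<in> borel_measurable N"
  shows "(\<lambda>x. crossing c (u x) (v x)) \<in> borel_measurable N"
  unfolding crossing_def by measurable

text \<open>A crossed t lies between c and x, so its distance to m is at most the larger of theirs.
  This turns a bound on h at t into a bound in terms of X.\<close>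

lemma crossing_imp_square_le:
  assumes "crossing c x t \<noteq> 0"
  shows "(t - m)\<^sup>2 \<le> (c - m)\<^sup>2 + (x - m)\<^sup>2"
proof -
  have "\<bar>t - m\<bar> \<le> \<bar>c - m\<bar> \<or> \<bar>t - m\<bar> \<le> \<bar>x - m\<bar>"
    using assms by (auto simp: crossing_def split: if_splits)
  then show ?thesis
    unfolding abs_le_square_iff using zero_le_power2[of "c - m"] zero_le_power2[of "x - m"] by linarith
qed

text \<open>For c \<le> t the crossing is the indicator of X > t, and E (X - mu) = 0 exchanges upper
  and lower tail; for c > t it is minus the indicator of X \<le> t. The result does not involve c,
  which may therefore be chosen to suit each case.\<close>

lemma (in prob_space) expectation_crossing:
  assumes X: "integrable M X"
  shows "(\<integral>\<omega>. (X \<omega> - expectation X) * crossing c (X \<omega>) t \<partial>M)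
    = (\<integral>\<omega>. (expectation X - X \<omega>) * indicator {..t} (X \<omega>) \<partial>M)"
proof -
  have [measurable]: "X \<in> borel_measurable M" using X by auto
  have int: "integrable M (\<lambda>\<omega>. (expectation X - X \<omega>) * indicator {..t} (X \<omega>))"
    by (rule Bochner_Integration.integrable_bound[of M "\<lambda>\<omega>. expectation X - X \<omega>"])
       (use X in \<open>auto simp: indicator_def\<close>)
  show ?thesis
  proof (cases "c \<le> t")
    case True
    have "(\<integral>\<omega>. (X \<omega> - expectation X) * crossing c (X \<omega>) t \<partial>M)
        = (\<integral>\<omega>. (X \<omega> - expectation X) + (expectation X - X \<omega>) * indicator {..t} (X \<omega>) \<partial>M)"
      using True by (intro Bochner_Integration.integral_cong) (auto simp: crossing_def indicator_def)
    also have "\<dots> = (\<integral>\<omega>. (expectation X - X \<omega>) * indicator {..t} (X \<omega>) \<partial>M)"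
      using X int by (subst Bochner_Integration.integral_add) (auto simp: prob_space)
    finally show ?thesis .
  next
    case False
    then show ?thesis
      by (intro Bochner_Integration.integral_cong) (auto simp: crossing_def indicator_def)
  qed
qed

text \<open>
  Writing \<open>H (X) = \<integral> h(t) crossing c X t dN(t)\<close>, Fubini's theorem turns the tail identity
  \<open>E[(\<mu> - X) 1\<^bsub>X \<le> t\<^esub>] = q t f t\<close> into Stein's covariance identity. Lebesgue measure gives
  the case of a density, the counting measure on the integers that of a mass function.
\<close>

lemma (in prob_space) stein_identity:
  fixes X :: "'a \<Rightarrow> real" and Y :: "'a \<Rightarrow> 'b" and \<tau> h q f :: "'b \<Rightarrow> real" and H :: "real \<Rightarrow> real"
  defines "mu \<equiv> expectation X"
  assumes X[measurable]: "X \<in> borel_measurable M"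
    and fourth: "integrable M (\<lambda>\<omega>. X \<omega> ^ 4)"
    and N: "sigma_finite_measure N"
    and Y: "distributed M N Y (\<lambda>x. ennreal (f x))" and f: "\<And>t. 0 \<le> f t"
    and [measurable]: "\<tau> \<in> borel_measurable N" "h \<in> borel_measurable N" "q \<in> borel_measurable N"
    and tail: "\<And>t. t \<in> space N \<Longrightarrow> (\<integral>\<omega>. (mu - X \<omega>) * indicator {..\<tau> t} (X \<omega>) \<partial>M) = q t * f t"
    and bound: "\<And>t. \<bar>h t\<bar> \<le> C * (1 + (\<tau> t - mu)\<^sup>2)"
    and len_int: "\<And>\<omega>. \<omega> \<in> space M \<Longrightarrow> integrable N (\<lambda>t. crossing c (X \<omega>) (\<tau> t))"
    and len: "\<And>\<omega>. \<omega> \<in> space M \<Longrightarrow> (\<integral>t. \<bar>crossing c (X \<omega>) (\<tau> t)\<bar> \<partial>N) \<le> \<bar>X \<omega> - c\<bar>"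
    and H: "\<And>\<omega>. \<omega> \<in> space M \<Longrightarrow> (\<integral>t. h t * crossing c (X \<omega>) (\<tau> t) \<partial>N) = H (X \<omega>)"
  shows "(\<integral>\<omega>. (X \<omega> - mu) * H (X \<omega>) \<partial>M) = (\<integral>\<omega>. h (Y \<omega>) * q (Y \<omega>) \<partial>M)"
proof -
  interpret N: sigma_finite_measure N by (rule N)
  interpret MN: pair_sigma_finite M N ..
  have intX: "integrable M X"
    using integrable_centered_power[OF X fourth, of 1 0] by simp
  have powers: "integrable M (\<lambda>\<omega>. \<bar>X \<omega> - mu\<bar> ^ k)" if "k \<le> 4" for k
    using integrable_abs[OF integrable_centered_power[OF X fourth that, of mu]] by (simp add: power_abs)
  define e where "e = \<bar>c - mu\<bar>"
  have e: "0 \<le> e" by (simp add: e_def)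
  have "0 \<le> C * (1 + (\<tau> t - mu)\<^sup>2)" for t
    using bound[of t] by linarith
  then have C: "0 \<le> C"
    by (metis add_pos_nonneg zero_le_mult_iff zero_le_power2 zero_less_one not_le)
  define b where "b x = C * (1 + e\<^sup>2 + (x - mu)\<^sup>2)" for x
  have hb: "\<bar>h t * crossing c x (\<tau> t)\<bar> \<le> b x * \<bar>crossing c x (\<tau> t)\<bar>" for t x
  proof (cases "crossing c x (\<tau> t) = 0")
    case False
    have "\<bar>h t\<bar> \<le> b x"
      using bound[of t] mult_left_mono[OF crossing_imp_square_le[OF False, of mu] C]
      by (simp add: b_def e_def algebra_simps)
    then show ?thesis by (simp add: abs_mult mult_right_mono)
  qed simp
  have h_int: "integrable N (\<lambda>t. h t * crossing c (X \<omega>) (\<tau> t))" if "\<omega> \<in> space M" for \<omega>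
    using hb[of _ "X \<omega>"]
    by (intro Bochner_Integration.integrable_bound[OF integrable_mult_right[OF integrable_abs[OF len_int[OF that]], of "b (X \<omega>)"]])
       (auto intro!: AE_I2 intro: order_trans[OF _ abs_ge_self])
  let ?\<Phi> = "\<lambda>\<omega> t. (X \<omega> - mu) * (h t * crossing c (X \<omega>) (\<tau> t))"
  \<comment> \<open>With z = |X - mu|: the factors z, \<open>b\<close> (quadratic) and the length |X
    - c| (linear) multiply to degree 4. Bounding the last two by multiples of 1 + z^2 and 1 + z
    gives z (1 + z^2) (1 + z) = z + z^2 + z^3 + z^4.\<close>
  have abs_le: "(\<integral>t. \<bar>?\<Phi> \<omega> t\<bar> \<partial>N)
      \<le> C * (1 + e) * (1 + e\<^sup>2) * (\<Sum>k=1..4. \<bar>X \<omega> - mu\<bar> ^ k)" if \<omega>: "\<omega> \<in> space M" for \<omega>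
  proof -
    let ?z = "\<bar>X \<omega> - mu\<bar>"
    have "(\<integral>t. \<bar>?\<Phi> \<omega> t\<bar> \<partial>N) = ?z * (\<integral>t. \<bar>h t * crossing c (X \<omega>) (\<tau> t)\<bar> \<partial>N)"
      by (simp add: abs_mult)
    also have "\<dots> \<le> ?z * (\<integral>t. b (X \<omega>) * \<bar>crossing c (X \<omega>) (\<tau> t)\<bar> \<partial>N)"
      using h_int[OF \<omega>] len_int[OF \<omega>] hb by (intro mult_left_mono integral_mono) auto
    also have "\<dots> \<le> ?z * (b (X \<omega>) * \<bar>X \<omega> - c\<bar>)"
      using len[OF \<omega>] C by (auto intro!: mult_left_mono simp: b_def)
    also have "\<dots> \<le> ?z * (C * ((1 + e\<^sup>2) * (1 + ?z\<^sup>2)) * ((1 + e) * (1 + ?z)))"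
    proof -
      have "b (X \<omega>) \<le> C * ((1 + e\<^sup>2) * (1 + ?z\<^sup>2))"
        unfolding b_def using C by (intro mult_left_mono) (auto simp: algebra_simps)
      moreover have "\<bar>X \<omega> - c\<bar> \<le> ?z + e"
        unfolding e_def by linarith
      then have "\<bar>X \<omega> - c\<bar> \<le> (1 + e) * (1 + ?z)"
        using mult_nonneg_nonneg[OF e, of ?z] by (simp add: algebra_simps)
      ultimately show ?thesis
        using C e by (intro mult_left_mono mult_mono) auto
    qed
    also have "\<dots> = C * (1 + e) * (1 + e\<^sup>2) * (\<Sum>k=1..4. ?z ^ k)"
      by (simp add: numeral_eq_Suc algebra_simps)
    finally show ?thesis .
  qed
  have \<Phi>: "integrable (M \<Otimes>\<^sub>M N) (case_prod ?\<Phi>)"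
  proof (rule MN.Fubini_integrable)
    show "case_prod ?\<Phi> \<in> borel_measurable (M \<Otimes>\<^sub>M N)" by measurable
    show "integrable M (\<lambda>\<omega>. \<integral>t. norm (case (\<omega>, t) of (\<omega>, t) \<Rightarrow> ?\<Phi> \<omega> t) \<partial>N)"
    proof (rule Bochner_Integration.integrable_bound)
      show "integrable M (\<lambda>\<omega>. C * (1 + e) * (1 + e\<^sup>2) * (\<Sum>k=1..4. \<bar>X \<omega> - mu\<bar> ^ k))"
        by (intro integrable_mult_right Bochner_Integration.integrable_sum powers) auto
      show "(\<lambda>\<omega>. \<integral>t. norm (case (\<omega>, t) of (\<omega>, t) \<Rightarrow> ?\<Phi> \<omega> t) \<partial>N) \<in> borel_measurable M"
        by measurable
      show "AE \<omega> in M. norm (\<integral>t. norm (case (\<omega>, t) of (\<omega>, t) \<Rightarrow> ?\<Phi> \<omega> t) \<partial>N)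
          \<le> norm (C * (1 + e) * (1 + e\<^sup>2) * (\<Sum>k=1..4. \<bar>X \<omega> - mu\<bar> ^ k))"
        using abs_le by (intro AE_I2) (auto intro: order_trans[OF _ abs_ge_self])
    qed
    show "AE \<omega> in M. integrable N (\<lambda>t. case (\<omega>, t) of (\<omega>, t) \<Rightarrow> ?\<Phi> \<omega> t)"
      using h_int by (intro AE_I2) simp
  qed
  have "(\<integral>\<omega>. (X \<omega> - mu) * H (X \<omega>) \<partial>M) = (\<integral>\<omega>. (\<integral>t. ?\<Phi> \<omega> t \<partial>N) \<partial>M)"
    by (intro Bochner_Integration.integral_cong) (simp_all add: H)
  also have "\<dots> = (\<integral>t. (\<integral>\<omega>. ?\<Phi> \<omega> t \<partial>M) \<partial>N)"
    using MN.integral_fst[OF \<Phi>] MN.integral_snd[OF \<Phi>] by simp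
  also have "\<dots> = (\<integral>t. f t * (h t * q t) \<partial>N)"
  proof (intro Bochner_Integration.integral_cong refl)
    fix t assume t: "t \<in> space N"
    have "(\<integral>\<omega>. ?\<Phi> \<omega> t \<partial>M) = h t * (\<integral>\<omega>. (X \<omega> - mu) * crossing c (X \<omega>) (\<tau> t) \<partial>M)"
      by (subst integral_mult_right_zero[symmetric]) (simp add: ac_simps)
    then show "(\<integral>\<omega>. ?\<Phi> \<omega> t \<partial>M) = f t * (h t * q t)"
      using expectation_crossing[OF intX, of c "\<tau> t"] tail[OF t] by (simp add: mu_def)
  qed
  also have "\<dots> = (\<integral>\<omega>. h (Y \<omega>) * q (Y \<omega>) \<partial>M)"
    by (intro distributed_integral[OF Y]) (auto simp: f)
  finally show ?thesis .
qed

text \<open>Evaluates the right-hand side of Stein's identity. The quadratic in Z stands for the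
  derivative or difference of a power up to 3, so one expansion serves every equation of both cases;
  the products a1 * \<gamma> and a0 * \<beta> disappear with E Z = 0.\<close>

lemma (in prob_space) integral_centered_cubic_quadratic:
  fixes X :: "'a \<Rightarrow> real"
  defines "mu \<equiv> expectation X"
  assumes X: "X \<in> borel_measurable M" and fourth: "integrable M (\<lambda>\<omega>. X \<omega> ^ 4)"
  shows "(\<integral>\<omega>. (a2 * (X \<omega> - mu)^2 + a1 * (X \<omega> - mu) + a0) * pearson_q \<delta> \<beta> \<gamma> mu (X \<omega>) \<partial>M)
    = a2 * (\<delta> * pop_cmom M X 4 + \<beta> * pop_cmom M X 3 + \<gamma> * pop_cmom M X 2)
    + a1 * (\<delta> * pop_cmom M X 3 + \<beta> * pop_cmom M X 2) + a0 * (\<delta> * pop_cmom M X 2 + \<gamma>)"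
proof -
  let ?Z = "\<lambda>\<omega>. X \<omega> - mu"
  have int: "integrable M (\<lambda>\<omega>. ?Z \<omega> ^ 4)" "integrable M (\<lambda>\<omega>. ?Z \<omega> ^ 3)"
    "integrable M (\<lambda>\<omega>. ?Z \<omega> ^ 2)" "integrable M (\<lambda>\<omega>. ?Z \<omega> ^ 1)" "integrable M (\<lambda>\<omega>. ?Z \<omega> ^ 0)"
    by (intro integrable_centered_power[OF X fourth]; simp)+
  have "integrable M X"
    using integrable_centered_power[OF X fourth, of 1 0] by simp
  then have 0: "pop_cmom M X 1 = 0" by (rule pop_cmom_1)
  have mom: "pop_cmom M X k = (\<integral>\<omega>. ?Z \<omega> ^ k \<partial>M)" for k
    by (simp add: pop_cmom_def mu_def)
  have "(\<integral>\<omega>. (a2 * (?Z \<omega>)^2 + a1 * ?Z \<omega> + a0) * pearson_q \<delta> \<beta> \<gamma> mu (X \<omega>) \<partial>M)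
    = (\<integral>\<omega>. a2 * \<delta> * ?Z \<omega> ^ 4 + (a2 * \<beta> + a1 * \<delta>) * ?Z \<omega> ^ 3 + (a2 * \<gamma> + a1 * \<beta> + a0 * \<delta>) * ?Z \<omega> ^ 2
        + (a1 * \<gamma> + a0 * \<beta>) * ?Z \<omega> ^ 1 + a0 * \<gamma> * ?Z \<omega> ^ 0 \<partial>M)"
    unfolding pearson_q_def
    by (intro Bochner_Integration.integral_cong refl) (simp, algebra)
  also have "\<dots> = a2 * \<delta> * pop_cmom M X 4 + (a2 * \<beta> + a1 * \<delta>) * pop_cmom M X 3
      + (a2 * \<gamma> + a1 * \<beta> + a0 * \<delta>) * pop_cmom M X 2
      + (a1 * \<gamma> + a0 * \<beta>) * pop_cmom M X 1 + a0 * \<gamma> * pop_cmom M X 0"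
    unfolding mom using int by (simp del: power_0 power_one_right)
  also have "\<dots> = a2 * (\<delta> * pop_cmom M X 4 + \<beta> * pop_cmom M X 3 + \<gamma> * pop_cmom M X 2)
    + a1 * (\<delta> * pop_cmom M X 3 + \<beta> * pop_cmom M X 2) + a0 * (\<delta> * pop_cmom M X 2 + \<gamma>)"
    using 0 by (simp add: pop_cmom_def prob_space algebra_simps)
  finally show ?thesis .
qed

section \<open>Crossing integrals for Lebesgue and counting measure\<close>

lemma abs_crossing: "\<bar>crossing c x t\<bar> = sgn (x - c) * crossing c x t"
  by (auto simp: crossing_def sgn_if)

lemma has_bochner_integral_crossing_lborel:
  fixes G h :: "real \<Rightarrow> real"
  assumes G: "\<And>t. (G has_real_derivative h t) (at t)" and h: "\<And>t. isCont h t"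
  shows "has_bochner_integral lborel (\<lambda>t. h t * crossing c x t) (G x - G c)"
proof -
  have [measurable]: "h \<in> borel_measurable borel"
    using h by (intro borel_measurable_continuous_onI continuous_at_imp_continuous_on) auto
  have *: "has_bochner_integral lborel (\<lambda>t. h t * indicator {a..b} t) (G b - G a)" if "a \<le> b" for a b
    using that G h by (intro has_bochner_integral_FTC_Icc_real)
  show ?thesis
  proof (cases "c \<le> x")
    case True
    \<comment> \<open>The fundamental theorem uses the closed interval; it differs from the crossing
      only at the null point x, and at c in the opposite case.\<close>
    have "AE t in lborel. h t * indicator {c..x} t = h t * crossing c x t"
      using AE_lborel_singleton[of x]
      by eventually_elim (use True in \<open>auto simp: crossing_def indicator_def\<close>)
    with *[OF True] show ?thesis
      by (subst has_bochner_integral_cong_AE[where g="\<lambda>t. h t * indicator {c..x} t"]) auto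
  next
    case False
    have "AE t in lborel. - (h t * indicator {x..c} t) = h t * crossing c x t"
      using AE_lborel_singleton[of c]
      by eventually_elim (use False in \<open>auto simp: crossing_def indicator_def\<close>)
    with has_bochner_integral_minus[OF *[of x c]] False show ?thesis
      by (subst has_bochner_integral_cong_AE[where g="\<lambda>t. - (h t * indicator {x..c} t)"]) auto
  qed
qed

lemma sum_telescope_int:
  fixes G :: "int \<Rightarrow> 'a::ab_group_add"
  assumes "a \<le> b"
  shows "(\<Sum>t\<in>{a..<b}. G (t + 1) - G t) = G b - G a"
  using assms
proof (induction b rule: int_ge_induct)
  case (step i)
  have "{a..<i + 1} = insert i {a..<i}" using step.hyps by auto
  then show ?case using step.IH by simp
qed simp

lemma has_bochner_integral_crossing_count_space:
  fixes G h :: "int \<Rightarrow> real"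
  assumes h: "\<And>t. h t = G (t + 1) - G t"
  shows "has_bochner_integral (count_space UNIV) (\<lambda>t. h t * crossing (of_int c) (of_int x) (of_int t)) (G x - G c)"
proof -
  have *: "has_bochner_integral (count_space UNIV) (\<lambda>t. h t * indicator {a..<b} t) (G b - G a)"
    if "a \<le> b" for a b
  proof -
    have "integrable (count_space UNIV) (\<lambda>t. h t * indicator {a..<b} t)"
      using abs_summable_on_finite[of "{a..<b}" h]
      by (simp add: abs_summable_on_altdef set_integrable_def mult.commute)
    moreover have "(\<integral>t. h t * indicator {a..<b} t \<partial>count_space UNIV) = G b - G a"
      using infsetsum_finite[of "{a..<b}" h] sum_telescope_int[OF that, of G]
      by (simp add: infsetsum_altdef set_lebesgue_integral_def mult.commute h)
    ultimately show ?thesis by (simp add: has_bochner_integral_iff)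
  qed
  show ?thesis
  proof (cases "c \<le> x")
    case True
    have eq: "h t * crossing (of_int c) (of_int x) (of_int t) = h t * indicator {c..<x} t" for t
      using True by (auto simp: crossing_def indicator_def)
    show ?thesis unfolding eq using *[OF True] .
  next
    case False
    have eq: "h t * crossing (of_int c) (of_int x) (of_int t) = - (h t * indicator {x..<c} t)" for t
      using False by (auto simp: crossing_def indicator_def)
    show ?thesis unfolding eq using has_bochner_integral_minus[OF *[of x c]] False by simp
  qed
qed

lemma abs_quadratic_le:
  fixes a0 a1 a2 v :: real
  shows "\<bar>a2 * v^2 + a1 * v + a0\<bar> \<le> (\<bar>a0\<bar> + \<bar>a1\<bar> + \<bar>a2\<bar>) * (1 + v\<^sup>2)"
proof -
  have "\<bar>v\<bar> \<le> 1 + v\<^sup>2"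
    using zero_le_power2[of "\<bar>v\<bar> - 1"] by (simp add: power2_diff)
  then have "\<bar>a1\<bar> * \<bar>v\<bar> \<le> \<bar>a1\<bar> * (1 + v\<^sup>2)" by (intro mult_left_mono) auto
  moreover have "\<bar>a2 * v^2 + a1 * v + a0\<bar> \<le> \<bar>a2\<bar> * v^2 + \<bar>a1\<bar> * \<bar>v\<bar> + \<bar>a0\<bar>"
    by (intro order_trans[OF abs_triangle_ineq] add_mono) (auto simp: abs_mult)
  moreover have "0 \<le> \<bar>a0\<bar> * v\<^sup>2 + \<bar>a2\<bar>" by simp
  moreover have "(\<bar>a0\<bar> + \<bar>a1\<bar> + \<bar>a2\<bar>) * (1 + v\<^sup>2)
      = \<bar>a0\<bar> + \<bar>a1\<bar> * (1 + v\<^sup>2) + \<bar>a2\<bar> * v\<^sup>2 + (\<bar>a0\<bar> * v\<^sup>2 + \<bar>a2\<bar>)"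
    by (simp add: algebra_simps)
  ultimately show ?thesis by linarith
qed

text \<open>The constant d, which will be G (c), is multiplied by a variable of mean zero and drops
  out.\<close>

lemma (in prob_space) integral_centered_shifted_power:
  fixes X :: "'a \<Rightarrow> real"
  assumes X: "X \<in> borel_measurable M" and fourth: "integrable M (\<lambda>\<omega>. X \<omega> ^ 4)" and "k \<le> 3"
  shows "(\<integral>\<omega>. (X \<omega> - expectation X) * ((X \<omega> - expectation X) ^ k - d) \<partial>M) = pop_cmom M X (Suc k)"
proof -
  have "integrable M X"
    using integrable_centered_power[OF X fourth, of 1 0] by simp
  then have "(\<integral>\<omega>. (X \<omega> - expectation X) ^ Suc k - d * (X \<omega> - expectation X) \<partial>M) = pop_cmom M X (Suc k)"
    unfolding pop_cmom_def using integrable_centered_power[OF X fourth, of "Suc k"] assms(3)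
    by (subst Bochner_Integration.integral_diff) (auto simp: prob_space)
  then show ?thesis by (simp add: algebra_simps)
qed

section \<open>Moment equations from the Pearson identity\<close>

context prob_space
begin

lemma pearson_moment_eq_cont:
  fixes X :: "'a \<Rightarrow> real" and f :: "real \<Rightarrow> real"
  defines "mu \<equiv> expectation X"
  assumes X[measurable]: "X \<in> borel_measurable M" and fourth: "integrable M (\<lambda>\<omega>. X \<omega> ^ 4)"
    and f: "\<And>x. 0 \<le> f x" and dens: "distributed M lborel X (\<lambda>x. ennreal (f x))"
    and pearson: "\<And>x. (LBINT t:{..x}. (mu - t) * f t) = pearson_q \<delta> \<beta> \<gamma> mu x * f x"
    and "k \<le> 3" and deriv: "\<And>v. ((\<lambda>v. v ^ k) has_real_derivative a2 * v^2 + a1 * v + a0) (at v)"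
  shows "pop_cmom M X (Suc k) =
      a2 * (\<delta> * pop_cmom M X 4 + \<beta> * pop_cmom M X 3 + \<gamma> * pop_cmom M X 2)
    + a1 * (\<delta> * pop_cmom M X 3 + \<beta> * pop_cmom M X 2) + a0 * (\<delta> * pop_cmom M X 2 + \<gamma>)"
proof -
  let ?h = "\<lambda>t. a2 * (t - mu)^2 + a1 * (t - mu) + a0"
  have crossing1: "has_bochner_integral lborel (crossing mu x) (x - mu)" for x
    using has_bochner_integral_crossing_lborel[of "\<lambda>t. t" "\<lambda>_. 1" mu x] by simp
  \<comment> \<open>Here c = mu. The term (mu - mu)^k is G (c) as the fundamental theorem delivers
    it; it is 0 for k > 0 and 1 for k = 0.\<close>
  have "(\<integral>\<omega>. (X \<omega> - mu) * ((X \<omega> - mu) ^ k - (mu - mu) ^ k) \<partial>M)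
      = (\<integral>\<omega>. ?h (X \<omega>) * pearson_q \<delta> \<beta> \<gamma> mu (X \<omega>) \<partial>M)"
  proof (rule stein_identity[OF X fourth _ dens f, folded mu_def, where \<tau>="\<lambda>t. t" and c=mu
        and C="\<bar>a0\<bar> + \<bar>a1\<bar> + \<bar>a2\<bar>" and H="\<lambda>x. (x - mu) ^ k - (mu - mu) ^ k"])
    show "sigma_finite_measure lborel" by (rule sigma_finite_lborel)
    show "?h \<in> borel_measurable lborel" "pearson_q \<delta> \<beta> \<gamma> mu \<in> borel_measurable lborel"
      by (simp_all add: pearson_q_def[abs_def])
    show "(\<integral>\<omega>. (mu - X \<omega>) * indicator {..t} (X \<omega>) \<partial>M) = pearson_q \<delta> \<beta> \<gamma> mu t * f t" for t
      using distributed_integral[OF dens, of "\<lambda>x. (mu - x) * indicator {..t} x"] f pearson[of t]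
      by (simp add: set_lebesgue_integral_def ac_simps)
    show "\<bar>?h t\<bar> \<le> (\<bar>a0\<bar> + \<bar>a1\<bar> + \<bar>a2\<bar>) * (1 + (t - mu)\<^sup>2)" for t
      by (rule abs_quadratic_le)
    show "integrable lborel (\<lambda>t. crossing mu (X \<omega>) t)" for \<omega>
      using crossing1[of "X \<omega>"] by (simp add: has_bochner_integral_iff)
    \<comment> \<open>The sign of the crossing does not depend on t, so it can be pulled out of the
      integral.\<close>
    show "(\<integral>t. \<bar>crossing mu (X \<omega>) t\<bar> \<partial>lborel) \<le> \<bar>X \<omega> - mu\<bar>" for \<omega>
      using crossing1[of "X \<omega>"] by (simp add: has_bochner_integral_iff abs_crossing sgn_if)
    have "((\<lambda>t. (t - mu) ^ k) has_real_derivative ?h t) (at t)" for t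
    proof -
      have "((\<lambda>t. t - mu) has_real_derivative 1) (at t)"
        by (auto intro!: derivative_eq_intros)
      from DERIV_chain2[OF deriv this] show ?thesis by simp
    qed
    from has_bochner_integral_crossing_lborel[OF this, of mu]
    show "(\<integral>t. ?h t * crossing mu (X \<omega>) t \<partial>lborel) = (X \<omega> - mu) ^ k - (mu - mu) ^ k" for \<omega>
      by (simp add: has_bochner_integral_iff)
  qed auto
  then show ?thesis
    unfolding mu_def integral_centered_shifted_power[OF X fourth \<open>k \<le> 3\<close>]
      integral_centered_cubic_quadratic[OF X fourth] .
qed

text \<open>The floor recasts X with values in type \<open>int\<close>, so that counting measure can
  serve as reference measure; integrality of X makes the preimage of j the event X = j.\<close>

lemma distributed_int_pmf:
  fixes X :: "'a \<Rightarrow> real"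
  assumes X[measurable]: "X \<in> borel_measurable M" and "\<And>\<omega>. \<omega> \<in> space M \<Longrightarrow> X \<omega> \<in> \<int>"
  shows "distributed M (count_space UNIV) (\<lambda>\<omega>. \<lfloor>X \<omega>\<rfloor>) (\<lambda>j. ennreal (int_pmf M X j))"
  unfolding distributed_def
proof (intro conjI)
  show "distr M (count_space UNIV) (\<lambda>\<omega>. \<lfloor>X \<omega>\<rfloor>) = density (count_space UNIV) (\<lambda>j. ennreal (int_pmf M X j))"
  proof (rule measure_eqI_countable[where A=UNIV])
    fix j :: int
    have "(\<lambda>\<omega>. \<lfloor>X \<omega>\<rfloor>) -` {j} \<inter> space M = {\<omega> \<in> space M. X \<omega> = of_int j}"
      using assms(2) by (auto elim!: Ints_cases)
    then show "emeasure (distr M (count_space UNIV) (\<lambda>\<omega>. \<lfloor>X \<omega>\<rfloor>)) {j}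
        = emeasure (density (count_space UNIV) (\<lambda>j. ennreal (int_pmf M X j))) {j}"
      by (subst emeasure_distr) (auto simp: emeasure_density int_pmf_def emeasure_eq_measure nn_integral_count_space_indicator)
  qed auto
qed auto

lemma pearson_moment_eq_disc:
  fixes X :: "'a \<Rightarrow> real"
  defines "mu \<equiv> expectation X"
  assumes X[measurable]: "X \<in> borel_measurable M" and fourth: "integrable M (\<lambda>\<omega>. X \<omega> ^ 4)"
    and ints: "\<And>\<omega>. \<omega> \<in> space M \<Longrightarrow> X \<omega> \<in> \<int>"
    and pearson: "\<And>j::int. (\<Sum>\<^sub>\<infinity>k\<in>{..j}. (mu - real_of_int k) * int_pmf M X k)
                  = pearson_q \<delta> \<beta> \<gamma> mu (real_of_int j) * int_pmf M X j"
    and "k \<le> 3" and diff: "\<And>v::real. (v + 1) ^ k - v ^ k = a2 * v^2 + a1 * v + a0"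
  shows "pop_cmom M X (Suc k) =
      a2 * (\<delta> * pop_cmom M X 4 + \<beta> * pop_cmom M X 3 + \<gamma> * pop_cmom M X 2)
    + a1 * (\<delta> * pop_cmom M X 3 + \<beta> * pop_cmom M X 2) + a0 * (\<delta> * pop_cmom M X 2 + \<gamma>)"
proof -
  let ?Y = "\<lambda>\<omega>. \<lfloor>X \<omega>\<rfloor>" and ?p = "int_pmf M X"
  let ?h = "\<lambda>t. a2 * (t - mu)^2 + a1 * (t - mu) + a0"
  have Y: "distributed M (count_space UNIV) ?Y (\<lambda>j. ennreal (?p j))"
    by (rule distributed_int_pmf[OF X ints])
  have p: "0 \<le> ?p j" for j by (simp add: int_pmf_def)
  have XY: "real_of_int (?Y \<omega>) = X \<omega>" if "\<omega> \<in> space M" for \<omega>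
    using ints[OF that] by (auto elim: Ints_cases)
  have intX: "integrable M X"
    using integrable_centered_power[OF X fourth, of 1 0] by simp
  have crossing1: "has_bochner_integral (count_space UNIV) (\<lambda>t. crossing 0 (X \<omega>) (of_int t)) (X \<omega> - 0)"
    if "\<omega> \<in> space M" for \<omega>
    using has_bochner_integral_crossing_count_space[of "\<lambda>_. 1" of_int 0 "?Y \<omega>"] XY[OF that] by simp
  \<comment> \<open>The telescoping sum must start at an integer, which mu need not be; hence c = 0
    here.\<close>
  have "(\<integral>\<omega>. (X \<omega> - mu) * ((X \<omega> - mu) ^ k - (0 - mu) ^ k) \<partial>M)
      = (\<integral>\<omega>. ?h (of_int (?Y \<omega>)) * pearson_q \<delta> \<beta> \<gamma> mu (of_int (?Y \<omega>)) \<partial>M)"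
  proof (rule stein_identity[OF X fourth _ Y p, folded mu_def, where \<tau>=of_int and c=0
        and C="\<bar>a0\<bar> + \<bar>a1\<bar> + \<bar>a2\<bar>" and H="\<lambda>x. (x - mu) ^ k - (0 - mu) ^ k"])
    show "sigma_finite_measure (count_space (UNIV::int set))"
      by (rule sigma_finite_measure_count_space)
    show "(\<integral>\<omega>. (mu - X \<omega>) * indicator {..of_int t} (X \<omega>) \<partial>M) = pearson_q \<delta> \<beta> \<gamma> mu (of_int t) * ?p t" for t
    proof -
      let ?g = "\<lambda>j. (mu - of_int j) * indicator {..t} j :: real"
      have g: "?g (?Y \<omega>) = (mu - X \<omega>) * indicator {..of_int t} (X \<omega>)" if "\<omega> \<in> space M" for \<omega>
        using XY[OF that] by (auto simp: indicator_def le_floor_iff floor_le_iff)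
      have "integrable M (\<lambda>\<omega>. (mu - X \<omega>) * indicator {..of_int t} (X \<omega>))"
        by (rule Bochner_Integration.integrable_bound[of M "\<lambda>\<omega>. mu - X \<omega>"])
           (use intX in \<open>auto simp: indicator_def\<close>)
      then have "integrable M (\<lambda>\<omega>. ?g (?Y \<omega>))"
        by (subst Bochner_Integration.integrable_cong[OF refl g])
      then have "integrable (count_space UNIV) (\<lambda>j. ?p j * ?g j)"
        by (subst distributed_integrable[OF Y]) (auto simp: p)
      \<comment> \<open>The Pearson identity is stated with \<open>infsum\<close>, the integral over
        counting measure is an \<open>infsetsum\<close>; absolute summability, inherited from
        integrability of X, identifies the two.\<close>
      then have abs: "Infinite_Set_Sum.abs_summable_on (\<lambda>j. (mu - of_int j) * ?p j) {..t}"
        by (simp add: abs_summable_on_altdef set_integrable_def ac_simps)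
      have "(\<integral>\<omega>. (mu - X \<omega>) * indicator {..of_int t} (X \<omega>) \<partial>M) = (\<integral>\<omega>. ?g (?Y \<omega>) \<partial>M)"
        by (intro Bochner_Integration.integral_cong g[symmetric] refl)
      also have "\<dots> = (\<integral>j. ?p j * ?g j \<partial>count_space UNIV)"
        by (intro distributed_integral[OF Y, symmetric]) (auto simp: p)
      also have "\<dots> = infsetsum (\<lambda>j. (mu - of_int j) * ?p j) {..t}"
        by (simp add: infsetsum_altdef set_lebesgue_integral_def ac_simps)
      also have "\<dots> = pearson_q \<delta> \<beta> \<gamma> mu (of_int t) * ?p t"
        unfolding infsetsum_infsum[OF abs] by (rule pearson)
      finally show ?thesis .
    qed
    show "\<bar>?h (of_int t)\<bar> \<le> (\<bar>a0\<bar> + \<bar>a1\<bar> + \<bar>a2\<bar>) * (1 + (of_int t - mu)\<^sup>2)" for t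
      by (rule abs_quadratic_le)
    show "integrable (count_space UNIV) (\<lambda>t. crossing 0 (X \<omega>) (of_int t))" if "\<omega> \<in> space M" for \<omega>
      using crossing1[OF that] by (simp add: has_bochner_integral_iff)
    show "(\<integral>t. \<bar>crossing 0 (X \<omega>) (of_int t)\<bar> \<partial>count_space UNIV) \<le> \<bar>X \<omega> - 0\<bar>" if "\<omega> \<in> space M" for \<omega>
      using crossing1[OF that] by (simp add: has_bochner_integral_iff abs_crossing sgn_if)
    have "?h (of_int t) = (of_int (t + 1) - mu) ^ k - (of_int t - mu) ^ k" for t
      using diff[of "of_int t - mu"] by (simp add: algebra_simps)
    note hb = has_bochner_integral_crossing_count_space[of "\<lambda>t. ?h (of_int t)" "\<lambda>t. (of_int t - mu) ^ k", OF this]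
    show "(\<integral>t. ?h (of_int t) * crossing 0 (X \<omega>) (of_int t) \<partial>count_space UNIV)
        = (X \<omega> - mu) ^ k - (0 - mu) ^ k" if "\<omega> \<in> space M" for \<omega>
      using hb[of 0 "?Y \<omega>"] XY[OF that] by (simp add: has_bochner_integral_iff)
  qed auto
  also have "\<dots> = (\<integral>\<omega>. ?h (X \<omega>) * pearson_q \<delta> \<beta> \<gamma> mu (X \<omega>) \<partial>M)"
    by (intro Bochner_Integration.integral_cong refl) (simp add: XY)
  finally show ?thesis
    unfolding mu_def integral_centered_shifted_power[OF X fourth \<open>k \<le> 3\<close>]
      integral_centered_cubic_quadratic[OF X fourth] .
qed

end

section \<open>Strong consistency\<close>

text \<open>Deviations from the sample mean are deviations from m minus their average
  \<open>A 1 n\<close>. Expanding binomially, every term with i < k carries a positive power of that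
  average, which tends to \<open>a 1\<close> = 0, so only i = k survives.\<close>

lemma sample_cmom_tendsto:
  assumes lim: "\<And>i. i \<le> k \<Longrightarrow> (\<lambda>n. (\<Sum>j<n. (Xs j \<omega> - m) ^ i) / real n) \<longlonglongrightarrow> a i"
    and a1: "a 1 = 0" and k: "1 \<le> k"
  shows "(\<lambda>n. sample_cmom Xs k n \<omega>) \<longlonglongrightarrow> a k"
proof -
  define A where "A i n = (\<Sum>j<n. (Xs j \<omega> - m) ^ i) / real n" for i n
  have A: "A i \<longlonglongrightarrow> a i" if "i \<le> k" for i
    unfolding A_def[abs_def] using lim[OF that] .
  have eq: "sample_cmom Xs k n \<omega> = (\<Sum>i\<le>k. of_nat (k choose i) * A i n * (- A 1 n) ^ (k - i))"
    if n: "0 < n" for n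
  proof -
    define b where "b = - A 1 n"
    have mean: "Xs j \<omega> - sample_mean Xs n \<omega> = (Xs j \<omega> - m) + b" for j
      using n by (simp add: sample_mean_def A_def b_def sum_subtractf diff_divide_distrib)
    show ?thesis
      unfolding sample_cmom_def mean binomial_ring sum.swap[of _ "{..k}"] b_def[symmetric]
        sum_divide_distrib[of _ "{..k}"]
      by (simp add: sum_distrib_right[symmetric] sum_distrib_left[symmetric] A_def)
  qed
  have "(\<lambda>n. \<Sum>i\<le>k. of_nat (k choose i) * A i n * (- A 1 n) ^ (k - i))
      \<longlonglongrightarrow> (\<Sum>i\<le>k. of_nat (k choose i) * a i * (- a 1) ^ (k - i))"
    using k by (intro tendsto_intros A) auto
  also have "(\<Sum>i\<le>k. of_nat (k choose i) * a i * (- a 1) ^ (k - i)) = (\<Sum>i\<le>k. if i = k then a k else 0)"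
    by (intro sum.cong) (use a1 in \<open>auto simp: power_0_left\<close>)
  also have "\<dots> = a k" by simp
  finally have "(\<lambda>n. \<Sum>i\<le>k. of_nat (k choose i) * A i n * (- A 1 n) ^ (k - i)) \<longlonglongrightarrow> a k" .
  moreover have "eventually (\<lambda>n. (\<Sum>i\<le>k. of_nat (k choose i) * A i n * (- A 1 n) ^ (k - i)) = sample_cmom Xs k n \<omega>) sequentially"
    using eventually_gt_at_top[of 0] by eventually_elim (simp add: eq)
  ultimately show ?thesis
    by (rule Lim_transform_eventually)
qed

context prob_space
begin

lemma AE_sample_cmom_tendsto:
  fixes X :: "'a \<Rightarrow> real" and Xs :: "nat \<Rightarrow> 'a \<Rightarrow> real"
  assumes X[measurable]: "X \<in> borel_measurable M"
    and fourth: "integrable M (\<lambda>\<omega>. X \<omega> ^ 4)"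
    and indep: "indep_vars (\<lambda>_. borel) Xs UNIV"
    and distr: "\<And>i. distr M borel (Xs i) = distr M borel X"
  shows "AE \<omega> in M. \<forall>k\<in>{1..4}. (\<lambda>n. sample_cmom Xs k n \<omega>) \<longlonglongrightarrow> pop_cmom M X k"
proof -
  have Xs[measurable]: "Xs i \<in> borel_measurable M" for i
    using indep by (auto simp: indep_vars_def)
  let ?D = "distr M borel X"
  interpret D: prob_space ?D by (rule prob_space_distr) simp
  interpret S: sequence_space ?D ..
  \<comment> \<open>Independence says that the joint law of the whole sample sequence is the
    infinite product law; the strong law, proved on the sequence space, is then pulled back to
    \<open>M\<close>.\<close>
  have "distr M (PiM UNIV (\<lambda>_. borel)) (\<lambda>\<omega>. \<lambda>i\<in>UNIV. Xs i \<omega>) = (\<Pi>\<^sub>M i\<in>UNIV. distr M borel (Xs i))"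
    using indep by (subst indep_vars_iff_distr_eq_PiM'[symmetric]) auto
  then have S: "distr M (PiM UNIV (\<lambda>_. borel)) (\<lambda>\<omega> i. Xs i \<omega>) = S.S"
    by (simp add: distr restrict_def)
  let ?m = "expectation X"
  have "AE \<omega> in M. (\<lambda>n. (\<Sum>j<n. (Xs j \<omega> - ?m) ^ i) / real n) \<longlonglongrightarrow> pop_cmom M X i" if "i \<le> 4" for i
  proof -
    have "integrable ?D (\<lambda>x. (x - ?m) ^ i)"
      using integrable_centered_power[OF X fourth that] by (subst integrable_distr_eq) auto
    from S.strong_law_of_large_numbers[OF this]
    have "AE x in S.S. (\<lambda>n. (\<Sum>j<n. (x j - ?m) ^ i) / real n) \<longlonglongrightarrow> pop_cmom M X i"
      by (simp add: integral_distr pop_cmom_def)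
    then have "AE x in distr M (PiM UNIV (\<lambda>_. borel)) (\<lambda>\<omega> i. Xs i \<omega>).
        (\<lambda>n. (\<Sum>j<n. (x j - ?m) ^ i) / real n) \<longlonglongrightarrow> pop_cmom M X i"
      unfolding S .
    then show ?thesis
      by (rule AE_distrD[rotated]) (auto intro!: measurable_PiM_single')
  qed
  then have "AE \<omega> in M. \<forall>i\<in>{..4}. (\<lambda>n. (\<Sum>j<n. (Xs j \<omega> - ?m) ^ i) / real n) \<longlonglongrightarrow> pop_cmom M X i"
    by (intro AE_finite_allI) auto
  moreover have "integrable M X"
    using integrable_centered_power[OF X fourth, of 1 0] by simp
  then have "pop_cmom M X 1 = 0" by (rule pop_cmom_1)
  ultimately show ?thesis
    by (auto elim!: eventually_mono intro!: sample_cmom_tendsto[where a="pop_cmom M X"])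
qed

section \<open>Nondegeneracy of the law and of the sample\<close>

lemma distributed_lborel_no_atoms:
  fixes X :: "'a \<Rightarrow> real"
  assumes "distributed M lborel X f"
  shows "AE \<omega> in M. X \<omega> \<noteq> a"
proof -
  have [measurable]: "X \<in> borel_measurable M" using assms by (auto simp: distributed_def)
  have "emeasure M (X -` {a} \<inter> space M) = (\<integral>\<^sup>+x. f x * indicator {a} x \<partial>lborel)"
    by (rule distributed_emeasure[OF assms]) simp
  also have "\<dots> = (\<integral>\<^sup>+x. 0 \<partial>(lborel :: real measure))"
  proof (rule nn_integral_cong_AE)
    show "AE x in lborel. f x * indicator {a} x = 0"
      using AE_lborel_singleton[of a] by eventually_elim simp
  qed
  finally show ?thesis
    by (intro AE_I[of _ _ "X -` {a} \<inter> space M"]) auto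
qed

text \<open>Every integer of positive mass would have to be a or b. The infinite case of
  \<open>three\<close> is listed separately because \<open>card\<close> is 0 on infinite
  sets.\<close>

lemma not_AE_two_points_int:
  assumes X[measurable]: "X \<in> borel_measurable M"
    and three: "infinite {j. int_pmf M X j > 0} \<or> card {j. int_pmf M X j > 0} \<ge> 3"
  shows "\<not> (AE \<omega> in M. X \<omega> = a \<or> X \<omega> = b)"
proof
  assume ae: "AE \<omega> in M. X \<omega> = a \<or> X \<omega> = b"
  \<comment> \<open>The points a and b are arbitrary reals; floors bring them to type
    \<open>int\<close>, and j = floor a whenever j = a.\<close>
  have "{j. int_pmf M X j > 0} \<subseteq> {\<lfloor>a\<rfloor>, \<lfloor>b\<rfloor>}"
  proof
    fix j assume "j \<in> {j. int_pmf M X j > 0}"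
    then have j: "0 < prob {\<omega> \<in> space M. X \<omega> = of_int j}" by (simp add: int_pmf_def)
    have "of_int j = a \<or> of_int j = b"
    proof (rule ccontr)
      assume "\<not> ?thesis"
      with ae have "AE \<omega> in M. \<not> X \<omega> = of_int j"
        by (auto elim!: eventually_mono)
      then have "prob {\<omega> \<in> space M. X \<omega> = of_int j} = 0"
        by (subst (asm) AE_iff_measurable[OF _ refl]) (auto simp: emeasure_eq_measure)
      with j show False by simp
    qed
    then show "j \<in> {\<lfloor>a\<rfloor>, \<lfloor>b\<rfloor>}" by auto
  qed
  then have "finite {j. int_pmf M X j > 0}" "card {j. int_pmf M X j > 0} \<le> card {\<lfloor>a\<rfloor>, \<lfloor>b\<rfloor>}"
    by (auto intro: finite_subset card_mono)
  moreover have "card {\<lfloor>a\<rfloor>, \<lfloor>b\<rfloor>} \<le> 2" by (simp add: card_insert_if)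
  ultimately show False using three by simp
qed

text \<open>There are countably many pairs of indices and each coincidence is a null event.\<close>

lemma AE_sample_distinct:
  fixes Xs :: "nat \<Rightarrow> 'a \<Rightarrow> real"
  assumes indep: "indep_vars (\<lambda>_. borel) Xs UNIV"
    and distr: "\<And>i. distr M borel (Xs i) = distr M borel X" and X[measurable]: "X \<in> borel_measurable M"
    and no_atoms: "\<And>a. AE \<omega> in M. X \<omega> \<noteq> a"
  shows "AE \<omega> in M. inj (\<lambda>i. Xs i \<omega>)"
proof -
  have Xs[measurable]: "Xs i \<in> borel_measurable M" for i
    using indep by (auto simp: indep_vars_def)
  have "AE \<omega> in M. Xs i \<omega> \<noteq> Xs j \<omega>" if "i \<noteq> j" for i j
  proof (rule AE_indep_var_neq)
    \<comment> \<open>Pairwise independence comes from restricting the family to the singletons {i}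
      and {j} and then evaluating at their only index.\<close>
    have "indep_var (PiM {i} (\<lambda>_. borel)) (\<lambda>\<omega>. \<lambda>i\<in>{i}. Xs i \<omega>) (PiM {j} (\<lambda>_. borel)) (\<lambda>\<omega>. \<lambda>i\<in>{j}. Xs i \<omega>)"
      using that by (intro indep_var_restrict[OF indep]) auto
    from indep_var_compose[OF this, of "\<lambda>x. x i" borel "\<lambda>x. x j" borel]
    show "indep_var borel (Xs i) borel (Xs j)"
      by (simp add: comp_def)
    have "AE x in distr M borel X. x \<noteq> a" for a
      using no_atoms[of a] by (subst AE_distr_iff) auto
    then have "AE \<omega> in M. Xs i \<omega> \<noteq> a" for a
      unfolding distr[of i, symmetric] by (subst (asm) AE_distr_iff) auto
    then show "prob {\<omega> \<in> space M. Xs i \<omega> = a} = 0" for a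
      by (subst (asm) AE_iff_measurable[OF _ refl]) (auto simp: emeasure_eq_measure)
  qed
  then have "AE \<omega> in M. \<forall>i j. i \<noteq> j \<longrightarrow> Xs i \<omega> \<noteq> Xs j \<omega>"
    by (simp add: AE_all_countable)
  then show ?thesis
    by eventually_elim (auto simp: inj_on_def)
qed

end

theorem theorem2p1:
  fixes M :: "'a measure" and X :: "'a \<Rightarrow> real" and Xs :: "nat \<Rightarrow> 'a \<Rightarrow> real"
    and f :: "real \<Rightarrow> real" and \<delta> \<beta> \<gamma> :: real
  defines "mu \<equiv> integral\<^sup>L M X"
  assumes P: "prob_space M"
    and rv: "X \<in> borel_measurable M"
    and fourth: "integrable M (\<lambda>\<omega>. X \<omega> ^ 4)"
    and sample_indep: "prob_space.indep_vars M (\<lambda>_. borel) Xs UNIV"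
    and sample_distr: "\<forall>i. distr M borel (Xs i) = distr M borel X"
  shows
    "((\<forall>\<omega>\<in>space M. X \<omega> \<in> \<int>)
      \<and> (\<forall>j::int. (\<Sum>\<^sub>\<infinity>k\<in>{..j}. (mu - real_of_int k) * int_pmf M X k)
                  = pearson_q \<delta> \<beta> \<gamma> mu (real_of_int j) * int_pmf M X j)
      \<and> (infinite {j. int_pmf M X j > 0} \<or> card {j. int_pmf M X j > 0} \<ge> 3)
     \<longrightarrow>
      \<delta> = delta_disc (pop_cmom M X 2) (pop_cmom M X 3) (pop_cmom M X 4)
      \<and> \<beta> = beta_disc (pop_cmom M X 2) (pop_cmom M X 3) (pop_cmom M X 4)
      \<and> \<gamma> = gamma_disc (pop_cmom M X 2) (pop_cmom M X 3) (pop_cmom M X 4)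
      \<and> (\<forall>n. \<forall>\<omega>\<in>space M. card ((\<lambda>j. Xs j \<omega>) ` {..<n}) \<ge> 3 \<longrightarrow>
           (let m2 = sample_cmom Xs 2 n \<omega>; m3 = sample_cmom Xs 3 n \<omega>; m4 = sample_cmom Xs 4 n \<omega>
            in Theta m2 m3 m4 > 0
               \<and> beta_disc m2 m3 m4 = (m3 * (1 - 2 * delta_disc m2 m3 m4) - m2) / (2 * m2)
               \<and> gamma_disc m2 m3 m4 = m2 * (1 - delta_disc m2 m3 m4)))
      \<and> (AE \<omega> in M.
           (\<lambda>n. delta_disc (sample_cmom Xs 2 n \<omega>) (sample_cmom Xs 3 n \<omega>) (sample_cmom Xs 4 n \<omega>))
              \<longlonglongrightarrow> \<delta>
         \<and> (\<lambda>n. beta_disc (sample_cmom Xs 2 n \<omega>) (sample_cmom Xs 3 n \<omega>) (sample_cmom Xs 4 n \<omega>))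
              \<longlonglongrightarrow> \<beta>
         \<and> (\<lambda>n. gamma_disc (sample_cmom Xs 2 n \<omega>) (sample_cmom Xs 3 n \<omega>) (sample_cmom Xs 4 n \<omega>))
              \<longlonglongrightarrow> \<gamma>))
   \<and>
    ((\<forall>x. 0 \<le> f x) \<and> f \<in> borel_measurable borel
      \<and> distributed M lborel X (\<lambda>x. ennreal (f x))
      \<and> (\<forall>x. (LBINT t:{..x}. (mu - t) * f t) = pearson_q \<delta> \<beta> \<gamma> mu x * f x)
     \<longrightarrow>
      \<delta> = delta_cont (pop_cmom M X 2) (pop_cmom M X 3) (pop_cmom M X 4)
      \<and> \<beta> = beta_cont (pop_cmom M X 2) (pop_cmom M X 3) (pop_cmom M X 4)
      \<and> \<gamma> = gamma_cont (pop_cmom M X 2) (pop_cmom M X 3) (pop_cmom M X 4)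
      \<and> (\<forall>n\<ge>3. AE \<omega> in M.
           (let m2 = sample_cmom Xs 2 n \<omega>; m3 = sample_cmom Xs 3 n \<omega>; m4 = sample_cmom Xs 4 n \<omega>
            in Theta m2 m3 m4 > 0
               \<and> beta_cont m2 m3 m4 = m3 * (1 - 2 * delta_cont m2 m3 m4) / (2 * m2)
               \<and> gamma_cont m2 m3 m4 = m2 * (1 - delta_cont m2 m3 m4)))
      \<and> (AE \<omega> in M.
           (\<lambda>n. delta_cont (sample_cmom Xs 2 n \<omega>) (sample_cmom Xs 3 n \<omega>) (sample_cmom Xs 4 n \<omega>))
              \<longlonglongrightarrow> \<delta>
         \<and> (\<lambda>n. beta_cont (sample_cmom Xs 2 n \<omega>) (sample_cmom Xs 3 n \<omega>) (sample_cmom Xs 4 n \<omega>))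
              \<longlonglongrightarrow> \<beta>
         \<and> (\<lambda>n. gamma_cont (sample_cmom Xs 2 n \<omega>) (sample_cmom Xs 3 n \<omega>) (sample_cmom Xs 4 n \<omega>))
              \<longlonglongrightarrow> \<gamma>))"
proof -
  interpret prob_space M by (rule P)
  have ae_lim: "AE \<omega> in M. \<forall>k\<in>{1..4}. (\<lambda>n. sample_cmom Xs k n \<omega>) \<longlonglongrightarrow> pop_cmom M X k"
    using AE_sample_cmom_tendsto[OF rv fourth sample_indep] sample_distr by blast
  let ?m2 = "pop_cmom M X 2" and ?m3 = "pop_cmom M X 3" and ?m4 = "pop_cmom M X 4"
  have disc: "(\<delta> = delta_disc ?m2 ?m3 ?m4 \<and> \<beta> = beta_disc ?m2 ?m3 ?m4 \<and> \<gamma> = gamma_disc ?m2 ?m3 ?m4)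
      \<and> Theta ?m2 ?m3 ?m4 \<noteq> 0"
    if ints: "\<forall>\<omega>\<in>space M. X \<omega> \<in> \<int>"
      and pearson: "\<forall>j::int. (\<Sum>\<^sub>\<infinity>k\<in>{..j}. (mu - real_of_int k) * int_pmf M X k)
                  = pearson_q \<delta> \<beta> \<gamma> mu (real_of_int j) * int_pmf M X j"
      and three: "infinite {j. int_pmf M X j > 0} \<or> card {j. int_pmf M X j > 0} \<ge> 3"
  proof -
    note pos = pop_cmom_positive[OF rv fourth not_AE_two_points_int[OF rv three]]
    note eq = pearson_moment_eq_disc[OF rv fourth, folded mu_def, OF _ pearson[rule_format]]
    \<comment> \<open>The arguments of \<open>eq\<close> are k and the coefficients of (v + 1)^k -
      v^k: here 1, below 2 v + 1 and 3 v^2 + 3 v + 1.\<close>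
    have "?m2 = \<delta> * ?m2 + \<gamma>"
      using eq[of 1 0 0 1] ints by (simp add: numeral_eq_Suc)
    moreover have "?m3 = 2 * (\<delta> * ?m3 + \<beta> * ?m2) + (\<delta> * ?m2 + \<gamma>)"
      using eq[of 2 0 2 1] ints by (simp add: power2_eq_square algebra_simps)
    moreover have "?m4 = 3 * (\<delta> * ?m4 + \<beta> * ?m3 + \<gamma> * ?m2) + 3 * (\<delta> * ?m3 + \<beta> * ?m2) + (\<delta> * ?m2 + \<gamma>)"
      using eq[of 3 3 3 1] ints by (simp add: power2_eq_square power3_eq_cube algebra_simps)
    ultimately show ?thesis
      using pos by (intro conjI[OF moment_equations_disc]) auto
  qed
  have cont: "(\<delta> = delta_cont ?m2 ?m3 ?m4 \<and> \<beta> = beta_cont ?m2 ?m3 ?m4 \<and> \<gamma> = gamma_cont ?m2 ?m3 ?m4)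
      \<and> Theta ?m2 ?m3 ?m4 \<noteq> 0"
    if f: "\<forall>x. 0 \<le> f x" and dens: "distributed M lborel X (\<lambda>x. ennreal (f x))"
      and pearson: "\<forall>x. (LBINT t:{..x}. (mu - t) * f t) = pearson_q \<delta> \<beta> \<gamma> mu x * f x"
  proof -
    have "\<not> (AE \<omega> in M. X \<omega> = a \<or> X \<omega> = b)" for a b
    proof
      assume "AE \<omega> in M. X \<omega> = a \<or> X \<omega> = b"
      with distributed_lborel_no_atoms[OF dens, of a] distributed_lborel_no_atoms[OF dens, of b]
      have "AE \<omega> in M. False" by eventually_elim auto
      then show False by simp
    qed
    note pos = pop_cmom_positive[OF rv fourth this]
    note eq = pearson_moment_eq_cont[OF rv fourth _ dens, folded mu_def, OF f[rule_format] pearson[rule_format]]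
    have "?m2 = \<delta> * ?m2 + \<gamma>"
      using eq[of 1 0 0 1] by (simp add: numeral_eq_Suc)
    moreover have "?m3 = 2 * (\<delta> * ?m3 + \<beta> * ?m2)"
    proof -
      have "((\<lambda>v. v ^ 2) has_real_derivative 0 * v^2 + 2 * v + 0) (at v)" for v :: real
        by (auto intro!: derivative_eq_intros)
      from eq[OF _ this] show ?thesis by (simp add: numeral_eq_Suc algebra_simps)
    qed
    moreover have "?m4 = 3 * (\<delta> * ?m4 + \<beta> * ?m3 + \<gamma> * ?m2)"
    proof -
      have "((\<lambda>v. v ^ 3) has_real_derivative 3 * v^2 + 0 * v + 0) (at v)" for v :: real
        by (auto intro!: derivative_eq_intros)
      from eq[OF _ this] show ?thesis by (simp add: numeral_eq_Suc algebra_simps)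
    qed
    ultimately show ?thesis
      using pos by (intro conjI[OF moment_equations_cont]) auto
  qed
  \<comment> \<open>Injectivity of the whole sequence gives n distinct values among the first n,
    hence at least three, and the density case reduces to the same sample condition as the integer
    case.\<close>
  have distinct: "AE \<omega> in M. 3 \<le> card ((\<lambda>j. Xs j \<omega>) ` {..<n})"
    if dens: "distributed M lborel X (\<lambda>x. ennreal (f x))" and n: "3 \<le> n" for n
  proof -
    have "AE \<omega> in M. inj (\<lambda>i. Xs i \<omega>)"
      using sample_distr by (intro AE_sample_distinct[OF sample_indep _ rv distributed_lborel_no_atoms[OF dens]]) auto
    then show ?thesis
      using n by (auto elim!: eventually_mono simp: card_image inj_on_subset)
  qed
  have lim_disc: "AE \<omega> in M.
      (\<lambda>n. delta_disc (sample_cmom Xs 2 n \<omega>) (sample_cmom Xs 3 n \<omega>) (sample_cmom Xs 4 n \<omega>)) \<longlonglongrightarrow> delta_disc ?m2 ?m3 ?m4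
    \<and> (\<lambda>n. beta_disc (sample_cmom Xs 2 n \<omega>) (sample_cmom Xs 3 n \<omega>) (sample_cmom Xs 4 n \<omega>)) \<longlonglongrightarrow> beta_disc ?m2 ?m3 ?m4
    \<and> (\<lambda>n. gamma_disc (sample_cmom Xs 2 n \<omega>) (sample_cmom Xs 3 n \<omega>) (sample_cmom Xs 4 n \<omega>)) \<longlonglongrightarrow> gamma_disc ?m2 ?m3 ?m4"
    if "Theta ?m2 ?m3 ?m4 \<noteq> 0"
    using ae_lim by eventually_elim (intro conjI tendsto_estimators that; simp)
  have lim_cont: "AE \<omega> in M.
      (\<lambda>n. delta_cont (sample_cmom Xs 2 n \<omega>) (sample_cmom Xs 3 n \<omega>) (sample_cmom Xs 4 n \<omega>)) \<longlonglongrightarrow> delta_cont ?m2 ?m3 ?m4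
    \<and> (\<lambda>n. beta_cont (sample_cmom Xs 2 n \<omega>) (sample_cmom Xs 3 n \<omega>) (sample_cmom Xs 4 n \<omega>)) \<longlonglongrightarrow> beta_cont ?m2 ?m3 ?m4
    \<and> (\<lambda>n. gamma_cont (sample_cmom Xs 2 n \<omega>) (sample_cmom Xs 3 n \<omega>) (sample_cmom Xs 4 n \<omega>)) \<longlonglongrightarrow> gamma_cont ?m2 ?m3 ?m4"
    if "Theta ?m2 ?m3 ?m4 \<noteq> 0"
    using ae_lim by eventually_elim (intro conjI tendsto_estimators that; simp)
  have sample_disc: "let m2 = sample_cmom Xs 2 n \<omega>; m3 = sample_cmom Xs 3 n \<omega>; m4 = sample_cmom Xs 4 n \<omega>
      in Theta m2 m3 m4 > 0
         \<and> beta_disc m2 m3 m4 = (m3 * (1 - 2 * delta_disc m2 m3 m4) - m2) / (2 * m2)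
         \<and> gamma_disc m2 m3 m4 = m2 * (1 - delta_disc m2 m3 m4)"
    if "3 \<le> card ((\<lambda>j. Xs j \<omega>) ` {..<n})" for n \<omega>
    using sample_cmom_positive[of Xs \<omega> n, OF that] unfolding Let_def
    by (intro conjI beta_gamma_disc_alt) auto
  have sample_cont: "let m2 = sample_cmom Xs 2 n \<omega>; m3 = sample_cmom Xs 3 n \<omega>; m4 = sample_cmom Xs 4 n \<omega>
      in Theta m2 m3 m4 > 0
         \<and> beta_cont m2 m3 m4 = m3 * (1 - 2 * delta_cont m2 m3 m4) / (2 * m2)
         \<and> gamma_cont m2 m3 m4 = m2 * (1 - delta_cont m2 m3 m4)"
    if "3 \<le> card ((\<lambda>j. Xs j \<omega>) ` {..<n})" for n \<omega>
    using sample_cmom_positive[of Xs \<omega> n, OF that] unfolding Let_def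
    by (intro conjI beta_gamma_cont_alt) auto
  show ?thesis (is "(?disc_hyp \<longrightarrow> ?disc) \<and> (?cont_hyp \<longrightarrow> ?cont)")
  proof (rule conjI; rule impI; elim conjE)
    assume asm: "\<forall>\<omega>\<in>space M. X \<omega> \<in> \<int>"
      "\<forall>j::int. (\<Sum>\<^sub>\<infinity>k\<in>{..j}. (mu - real_of_int k) * int_pmf M X k)
                  = pearson_q \<delta> \<beta> \<gamma> mu (real_of_int j) * int_pmf M X j"
      "infinite {j. int_pmf M X j > 0} \<or> card {j. int_pmf M X j > 0} \<ge> 3"
    from disc[OF this] have eqs: "delta_disc ?m2 ?m3 ?m4 = \<delta>" "beta_disc ?m2 ?m3 ?m4 = \<beta>" "gamma_disc ?m2 ?m3 ?m4 = \<gamma>"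
      and Theta: "Theta ?m2 ?m3 ?m4 \<noteq> 0" by simp_all
    show ?disc
      using lim_disc[OF Theta] sample_disc unfolding eqs by blast
  next
    assume asm: "\<forall>x. 0 \<le> f x" "distributed M lborel X (\<lambda>x. ennreal (f x))"
      "\<forall>x. (LBINT t:{..x}. (mu - t) * f t) = pearson_q \<delta> \<beta> \<gamma> mu x * f x"
    from cont[OF this] have eqs: "delta_cont ?m2 ?m3 ?m4 = \<delta>" "beta_cont ?m2 ?m3 ?m4 = \<beta>" "gamma_cont ?m2 ?m3 ?m4 = \<gamma>"
      and Theta: "Theta ?m2 ?m3 ?m4 \<noteq> 0" by simp_all
    have "\<forall>n\<ge>3. AE \<omega> in M. let m2 = sample_cmom Xs 2 n \<omega>; m3 = sample_cmom Xs 3 n \<omega>; m4 = sample_cmom Xs 4 n \<omega>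
      in Theta m2 m3 m4 > 0
         \<and> beta_cont m2 m3 m4 = m3 * (1 - 2 * delta_cont m2 m3 m4) / (2 * m2)
         \<and> gamma_cont m2 m3 m4 = m2 * (1 - delta_cont m2 m3 m4)"
      by (intro allI impI eventually_mono[OF distinct[OF asm(2)]] sample_cont)
    with lim_cont[OF Theta] show ?cont
      unfolding eqs by blast
  qed
qed

end
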